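(* Let $\mathcal U$ be a finitely closed class of graphs such that every graph in $\mathcal U$ is pre-partitionable. Then every graph in $\overline{\mathcal U}$ is pre-partitionable.
   Context: A class $\mathcal U$ of graphs is finitely closed if it is closed under taking finite disjoint unions and under adding finitely many new vertices joined arbitrarily to each other and to the old vertices. For each ordinal $\mu$ define $\mathcal U(\mu)$ recursively: $\mathcal U(0)=\mathcal U$, and for $\mu>0$ a graph $G$ belongs to $\mathcal U(\mu)$ if it has a finite vertex set $S$ such that for every component $C$ of $G-S$ there is an ordinal $\lambda<\mu$ with $C\in\mathcal U(\lambda)$. The closure $\overline{\mathcal U}$ is the union of all $\mathcal U(\lambda)$ over all ordinals $\lambda$. A partition of a graph (or of a vertex set) $V$ is a function $\pi:V\to\{0,1\}$. For a vertex $x$, a neighbour $y$ of $x$ is an opponent of $x$ if $\pi(y)\neq\pi(x)$ and a friend if $\pi(y)=\pi(x)$; $x$ is happy in $\pi$ if the (cardinal) number of its opponents is at least the number of its friends. A graph $G$ is pre-partitionable if for every $U\subseteq V(G)$ and every partition $\pi$ of $U$ there is a partition $\pi'$ of $V(G)$ extending $\pi$ such that every vertex of $V(G)\setminus U$ is happy in $\pi'$. *)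

theory Defs
  imports Main "HOL-Library.Equipollence" "HOL-Library.FuncSet"
begin

unbundle cardinal_syntax

section \<open>Graphs\<close>

datatype 'a graph = Graph (verts: "'a set") (edges: "'a set set")

definition is_graph :: "'a graph \<Rightarrow> bool" where
  "is_graph G \<longleftrightarrow> (\<forall>e\<in>edges G. \<exists>x\<in>verts G. \<exists>y\<in>verts G. x \<noteq> y \<and> e = {x, y})"

definition adj :: "'a graph \<Rightarrow> 'a \<Rightarrow> 'a \<Rightarrow> bool" where
  "adj G x y \<longleftrightarrow> {x, y} \<in> edges G"

definition induced :: "'a graph \<Rightarrow> 'a set \<Rightarrow> 'a graph" where
  "induced G X = Graph (verts G \<inter> X) {e \<in> edges G. e \<subseteq> X}"

definition del_verts :: "'a graph \<Rightarrow> 'a set \<Rightarrow> 'a graph" where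
  "del_verts G S = induced G (verts G - S)"

definition components :: "'a graph \<Rightarrow> 'a graph set" where
  "components G = {induced G {y. (adj G)\<^sup>*\<^sup>* x y} | x. x \<in> verts G}"

definition graph_iso :: "'a graph \<Rightarrow> 'b graph \<Rightarrow> bool" where
  "graph_iso G H \<longleftrightarrow> (\<exists>f. bij_betw f (verts G) (verts H) \<and>
     (\<forall>x\<in>verts G. \<forall>y\<in>verts G. adj G x y \<longleftrightarrow> adj H (f x) (f y)))"

section \<open>Finitely closed classes\<close>

text \<open>A class of graphs is an isomorphism-invariant set of graphs with vertices in \<open>'a\<close>.
  If \<open>'a\<close> is infinite, every finite disjoint union of graphs on \<open>'a\<close>, and every extension of
  such a graph by finitely many vertices, has an isomorphic copy on \<open>'a\<close>. So the two closure
  conditions below, which only mention graphs that are literally disjoint and vertices that are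
  literally new, lose nothing.\<close>

definition graph_class :: "'a graph set \<Rightarrow> bool" where
  "graph_class \<U> \<longleftrightarrow> (\<forall>G\<in>\<U>. is_graph G) \<and>
     (\<forall>G\<in>\<U>. \<forall>H. is_graph H \<and> graph_iso G H \<longrightarrow> H \<in> \<U>)"

definition finitely_closed :: "'a graph set \<Rightarrow> bool" where
  "finitely_closed \<U> \<longleftrightarrow>
     (\<forall>G\<in>\<U>. \<forall>H\<in>\<U>. verts G \<inter> verts H = {} \<longrightarrow>
        Graph (verts G \<union> verts H) (edges G \<union> edges H) \<in> \<U>) \<and>
     (\<forall>H\<in>\<U>. \<forall>G. is_graph G \<and> verts H \<subseteq> verts G \<and> finite (verts G - verts H) \<and>
        induced G (verts H) = H \<longrightarrow> G \<in> \<U>)"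

section \<open>The ordinal hierarchy over a class\<close>

text \<open>An ordinal is represented by a well-order \<open>\<mu>\<close> on some type \<open>'o\<close>: the ordinal 0 is the
  empty relation, and \<open>\<kappa> < \<mu>\<close> is \<open>\<kappa> <o \<mu>\<close>, which entails that both are well-orders.\<close>

declare conj_cong [fundef_cong]

function stage :: "'a graph set \<Rightarrow> 'o rel \<Rightarrow> 'a graph set" where
  "stage \<U> \<mu> = (if \<mu> = {} then \<U> else
     {G. is_graph G \<and> (\<exists>S. finite S \<and> S \<subseteq> verts G \<and>
        (\<forall>C\<in>components (del_verts G S). \<exists>\<kappa> :: 'o rel. \<kappa> <o \<mu> \<and> C \<in> stage \<U> \<kappa>))})"
  by auto
termination
  by (relation "inv_image ordLess snd") (auto simp: wf_ordLess)

declare conj_cong [fundef_cong del]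

declare stage.simps [simp del]

lemma stage_empty: "stage \<U> {} = \<U>"
  by (subst stage.simps) simp

text \<open>HOL has no type of all ordinals. Well-orders on sets of graphs are long enough: the lemma
  \<open>stage_subset_graph_closure\<close> shows that no well-order on any type contributes further graphs.\<close>

definition graph_closure :: "'a graph set \<Rightarrow> 'a graph set" where
  "graph_closure \<U> = (\<Union>\<mu> \<in> {\<mu> :: 'a graph set rel. Well_order \<mu>}. stage \<U> \<mu>)"

lemma ordIso_empty_iff:
  fixes \<mu> :: "'o rel" and \<nu> :: "'p rel"
  assumes "\<mu> =o \<nu>"
  shows "\<mu> = {} \<longleftrightarrow> \<nu> = {}"
proof -
  obtain f where "iso \<mu> \<nu> f" using assms by (auto simp: ordIso_def)
  then have "bij_betw f (Field \<mu>) (Field \<nu>)" by (simp add: iso_def)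
  then have "Field \<mu> = {} \<longleftrightarrow> Field \<nu> = {}" by (auto simp: bij_betw_def)
  then show ?thesis by (auto simp: Field_def)
qed

lemma ordLess_transfer:
  fixes \<kappa> :: "'o rel" and \<mu> :: "'o rel" and \<nu> :: "'p rel"
  assumes "\<kappa> <o \<mu>" "\<mu> =o \<nu>"
  shows "\<exists>\<kappa>' :: 'p rel. \<kappa>' <o \<nu> \<and> \<kappa> =o \<kappa>'"
proof -
  have l: "\<kappa> <o \<nu>" using assms by (rule ordLess_ordIso_trans)
  have w: "Well_order \<kappa>" "Well_order \<nu>" using l by (auto simp: ordLess_def)
  obtain a where a: "a \<in> Field \<nu>" "\<kappa> =o Restr \<nu> (underS \<nu> a)"
    using l ordLess_iff_ordIso_Restr[OF w(2) w(1)] by blast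
  then show ?thesis using underS_Restr_ordLess[OF w(2)] by blast
qed

lemma stage_ordIso:
  fixes \<mu> :: "'o rel" and \<nu> :: "'p rel"
  assumes "\<mu> =o \<nu>"
  shows "stage \<U> \<mu> = stage \<U> \<nu>"
  using assms
proof (induction \<mu> arbitrary: \<nu> rule: wf_induct_rule[OF wf_ordLess])
  case (1 \<mu>)
  have e: "\<mu> = {} \<longleftrightarrow> \<nu> = {}" using 1(2) by (rule ordIso_empty_iff)
  have "(\<exists>\<kappa> :: 'o rel. \<kappa> <o \<mu> \<and> C \<in> stage \<U> \<kappa>) \<longleftrightarrow>
      (\<exists>\<kappa> :: 'p rel. \<kappa> <o \<nu> \<and> C \<in> stage \<U> \<kappa>)" for C
  proof
    assume "\<exists>\<kappa> :: 'o rel. \<kappa> <o \<mu> \<and> C \<in> stage \<U> \<kappa>"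
    then obtain \<kappa> :: "'o rel" where k: "\<kappa> <o \<mu>" "C \<in> stage \<U> \<kappa>" by blast
    from ordLess_transfer[OF k(1) 1(2)] obtain \<kappa>' :: "'p rel"
      where "\<kappa>' <o \<nu>" "\<kappa> =o \<kappa>'" by blast
    then show "\<exists>\<kappa> :: 'p rel. \<kappa> <o \<nu> \<and> C \<in> stage \<U> \<kappa>" using 1(1) k by blast
  next
    assume "\<exists>\<kappa> :: 'p rel. \<kappa> <o \<nu> \<and> C \<in> stage \<U> \<kappa>"
    then obtain \<kappa> :: "'p rel" where k: "\<kappa> <o \<nu>" "C \<in> stage \<U> \<kappa>" by blast
    from ordLess_transfer[OF k(1) ordIso_symmetric[OF 1(2)]]
    obtain \<kappa>' :: "'o rel" where "\<kappa>' <o \<mu>" "\<kappa> =o \<kappa>'" by blast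
    then show "\<exists>\<kappa> :: 'o rel. \<kappa> <o \<mu> \<and> C \<in> stage \<U> \<kappa>" using 1(1) k ordIso_symmetric by blast
  qed
  then show ?case using e by (simp add: stage.simps[of \<U> \<mu>] stage.simps[of \<U> \<nu>])
qed

lemma stage_subset_graph_closure:
  fixes \<mu> :: "'o rel" and \<U> :: "'a graph set"
  assumes "Well_order \<mu>"
  shows "stage \<U> \<mu> \<subseteq> graph_closure \<U>"
proof -
  obtain r :: "'a graph set rel" where r: "Well_order r" "Field r = UNIV"
    using well_ordering by (elim exE conjE) (rule that)
  define seg where "seg a = Restr r (underS r a)" for a
  define F where "F a = stage \<U> (seg a)" for a
  define step where "step X = {G :: 'a graph. is_graph G \<and>
    (\<exists>S. finite S \<and> S \<subseteq> verts G \<and> components (del_verts G S) \<subseteq> X)}" for X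
  have seg_wo: "Well_order (seg a)" for a
    unfolding seg_def using r(1) by (rule Well_order_Restr)
  have seg_less: "seg a <o seg b" if "(a, b) \<in> r" "a \<noteq> b" for a b
  proof -
    have wr: "wo_rel r" using r(1) by (simp add: wo_rel_def)
    have "trans r" "antisym r"
      using r(1) by (auto simp: order_on_defs)
    then have "underS r a \<subset> underS r b"
      using that by (auto simp: underS_def dest: transD antisymD)
    then show ?thesis unfolding seg_def
      using ofilter_subset_ordLess[OF r(1) wo_rel.underS_ofilter[OF wr] wo_rel.underS_ofilter[OF wr]]
      by blast
  qed
  have "\<exists>a. step (\<U> \<union> F a) \<subseteq> F a"
  proof (rule ccontr)
    assume "\<nexists>a. step (\<U> \<union> F a) \<subseteq> F a"
    then have "\<forall>a. \<exists>G. G \<in> step (\<U> \<union> F a) \<and> G \<notin> F a" by blast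
    then obtain g where g: "\<And>a. g a \<in> step (\<U> \<union> F a)" "\<And>a. g a \<notin> F a" by metis
    have later: "g a \<in> F b" if ab: "(a, b) \<in> r" "a \<noteq> b" for a b
    proof -
      have l: "seg a <o seg b" using ab by (rule seg_less)
      have ne: "seg b \<noteq> {}"
        using l ordLess_iff_ordIso_Restr[OF seg_wo[of b] seg_wo[of a]] by (auto simp: Field_def)
      have "\<not> seg b \<le>o ({} :: 'a graph set rel)"
      proof
        assume "seg b \<le>o ({} :: 'a graph set rel)"
        then obtain f where "embed (seg b) ({} :: 'a graph set rel) f"
          by (auto simp: ordLeq_def)
        then have "f ` Field (seg b) \<subseteq> Field ({} :: 'a graph set rel)"
          by (rule embed_Field)
        then have "Field (seg b) = {}" by simp
        then show False using ne by (auto simp: Field_def)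
      qed
      then have "({} :: 'a graph set rel) <o seg b"
        using ordLess_or_ordLeq[of "{} :: 'a graph set rel" "seg b"] seg_wo[of b] by simp
      moreover have "stage \<U> ({} :: 'a graph set rel) = \<U>" by (rule stage_empty)
      ultimately have "\<exists>\<kappa> :: 'a graph set rel. \<kappa> <o seg b \<and> C \<in> stage \<U> \<kappa>" if "C \<in> \<U> \<union> F a" for C
        using that l unfolding F_def by blast
      note comp = this
      obtain S where S: "is_graph (g a)" "finite S" "S \<subseteq> verts (g a)"
        "components (del_verts (g a) S) \<subseteq> \<U> \<union> F a"
        using g(1)[of a] unfolding step_def by blast
      have "\<forall>C\<in>components (del_verts (g a) S).
          \<exists>\<kappa> :: 'a graph set rel. \<kappa> <o seg b \<and> C \<in> stage \<U> \<kappa>"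
        using comp S(4) by (meson subsetD)
      then show ?thesis
        unfolding F_def stage.simps[of \<U> "seg b"] if_not_P[OF ne] mem_Collect_eq
        using S(1-3) by (intro conjI exI[of _ S]) assumption+
    qed
    have "inj g"
    proof (rule injI, rule ccontr)
      fix a b assume ab: "g a = g b" "a \<noteq> b"
      have "(a, b) \<in> r \<or> (b, a) \<in> r"
        using r ab(2) by (auto simp: order_on_defs total_on_def)
      then show False using later[of a b] later[of b a] g(2)[of a] g(2)[of b] ab by auto
    qed
    then have "surj (inv g)" by (rule inj_imp_surj_inv)
    then show False using Cantors_theorem[of "UNIV :: 'a graph set"] by (metis Pow_UNIV)
  qed
  then obtain a where a: "step (\<U> \<union> F a) \<subseteq> F a" by blast
  have "stage \<U> \<mu> \<subseteq> \<U> \<union> F a"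
    using assms
  proof (induction \<mu> rule: wf_induct_rule[OF wf_ordLess])
    case (1 \<mu>)
    show ?case
    proof (cases "\<mu> = {}")
      case True
      then show ?thesis by (simp add: stage_empty)
    next
      case False
      have "C \<in> \<U> \<union> F a" if "\<kappa> <o \<mu>" "C \<in> stage \<U> \<kappa>" for C and \<kappa> :: "'o rel"
        using 1(1)[OF that(1)] that by (auto simp: ordLess_def)
      note comp = this
      have "stage \<U> \<mu> \<subseteq> step (\<U> \<union> F a)"
      proof
        fix G assume "G \<in> stage \<U> \<mu>"
        then have "is_graph G \<and> (\<exists>S. finite S \<and> S \<subseteq> verts G \<and>
            (\<forall>C\<in>components (del_verts G S). \<exists>\<kappa> :: 'o rel. \<kappa> <o \<mu> \<and> C \<in> stage \<U> \<kappa>))"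
          unfolding stage.simps[of \<U> \<mu>] if_not_P[OF False] mem_Collect_eq .
        then obtain S where S: "is_graph G" "finite S" "S \<subseteq> verts G"
          "\<forall>C\<in>components (del_verts G S). \<exists>\<kappa> :: 'o rel. \<kappa> <o \<mu> \<and> C \<in> stage \<U> \<kappa>"
          by (elim conjE exE)
        have "components (del_verts G S) \<subseteq> \<U> \<union> F a"
          using S(4) comp by (meson subsetI)
        then show "G \<in> step (\<U> \<union> F a)"
          unfolding step_def mem_Collect_eq
          using S(1-3) by (intro conjI exI[of _ S]) assumption+
      qed
      then show ?thesis using a by blast
    qed
  qed
  moreover have "F a \<subseteq> graph_closure \<U>"
    using seg_wo[of a] unfolding graph_closure_def F_def by blast
  moreover have "\<U> \<subseteq> graph_closure \<U>"
  proof -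
    have "Well_order ({} :: 'a graph set rel)" by simp
    moreover have "stage \<U> ({} :: 'a graph set rel) = \<U>" by (rule stage_empty)
    ultimately show ?thesis unfolding graph_closure_def by blast
  qed
  ultimately show ?thesis by blast
qed

section \<open>Partitions\<close>

definition is_partition :: "('a \<Rightarrow> nat) \<Rightarrow> 'a set \<Rightarrow> bool" where
  "is_partition \<pi> V \<longleftrightarrow> \<pi> \<in> V \<rightarrow> {0, 1}"

definition opponents :: "'a graph \<Rightarrow> ('a \<Rightarrow> nat) \<Rightarrow> 'a \<Rightarrow> 'a set" where
  "opponents G \<pi> x = {y. adj G x y \<and> \<pi> y \<noteq> \<pi> x}"

definition friends :: "'a graph \<Rightarrow> ('a \<Rightarrow> nat) \<Rightarrow> 'a \<Rightarrow> 'a set" where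
  "friends G \<pi> x = {y. adj G x y \<and> \<pi> y = \<pi> x}"

definition happy :: "'a graph \<Rightarrow> ('a \<Rightarrow> nat) \<Rightarrow> 'a \<Rightarrow> bool" where
  "happy G \<pi> x \<longleftrightarrow> friends G \<pi> x \<lesssim> opponents G \<pi> x"

definition pre_partitionable :: "'a graph \<Rightarrow> bool" where
  "pre_partitionable G \<longleftrightarrow>
     (\<forall>X \<pi>. X \<subseteq> verts G \<and> is_partition \<pi> X \<longrightarrow>
        (\<exists>\<pi>'. is_partition \<pi>' (verts G) \<and> (\<forall>x\<in>X. \<pi>' x = \<pi> x) \<and>
           (\<forall>x\<in>verts G - X. happy G \<pi>' x)))"

end

theory Submission
  imports Defs
begin

(*
  Let S be the finite separator and consider a partial partition to be extended so that a free set R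
  is happy. Vertices outside S only see S and their own piece, so the problem is to make the
  vertices of R in S happy; this goes by induction on their number.
  Finite-degree vertices of S can be absorbed into a piece together with the finitely many pieces
  they see. If two infinite degrees differ, make the vertices of larger degree happy first; afterwards
  the vertices of degree at most L can be recoloured inside a region of size at most L, which no vertex
  of larger degree notices. If all degrees equal K > \<aleph>_0 and some family F of pieces
  contains K neighbours of one vertex of S but not of another, the same recolouring argument splits
  the problem. Otherwise every family of pieces is either large for all these vertices or small
  for all of them. For each colouring \<tau> of S take a maximal disjoint family of finite blocks of
  pieces that admit a happy partition inducing \<tau>; as there are finitely many \<tau>, one of these
  families is large, and gluing its blocks makes every vertex of S happy. Countable degrees are
  treated by the same block argument, small meaning finite.
  The ordinal hierarchy is replaced by a maximal family of vertex sets that is finitely closed and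
  pre-partitionable. The pieces are arbitrary unions of components, since \<U> need not be closed
  under taking components.
*)

section \<open>Cardinalities and happiness\<close>

text \<open>Happiness relative to a neighbourhood \<open>N\<close>. With
  \<open>N = nb x \<inter> W\<close> the same predicate serves for every induced subgraph.\<close>

definition content :: "'a set \<Rightarrow> ('a \<Rightarrow> bool) \<Rightarrow> 'a \<Rightarrow> bool" where
  "content N p x \<longleftrightarrow> |{y \<in> N. p y = p x}| \<le>o |{y \<in> N. p y \<noteq> p x}|"

lemma content_cong:
  assumes "N = M" "p x = q x" "\<And>y. y \<in> M \<Longrightarrow> p y = q y"
  shows "content N p x \<longleftrightarrow> content M q x"
proof -
  have "{y \<in> N. p y = p x} = {y \<in> M. q y = q x}" "{y \<in> N. p y \<noteq> p x} = {y \<in> M. q y \<noteq> q x}"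
    using assms by auto
  then show ?thesis by (simp add: content_def)
qed

lemma not_card_of_le_iff: "\<not> |A| \<le>o |B| \<longleftrightarrow> |B| <o |A|"
  by (rule not_ordLeq_iff_ordLess) (rule card_of_Well_order)+

lemma card_of_le_iff_card:
  assumes "finite A" "finite B"
  shows "|A| \<le>o |B| \<longleftrightarrow> card A \<le> card B"
  using inj_on_iff_card_le[OF assms] card_of_ordLeq[of A B] by simp

lemma card_of_finite_less_infinite:
  assumes "finite A" "infinite B"
  shows "|A| <o |B|"
proof -
  have "\<not> |B| \<le>o |A|" using assms card_of_ordLeq_finite by blast
  then show ?thesis by (simp add: not_card_of_le_iff)
qed

text \<open>An infinite cardinal is not the sum of two smaller ones, so dropping the smaller set
  \<open>D\<close> costs nothing.\<close>

lemma card_of_le_if_subset_Un: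
  assumes "A \<subseteq> X \<union> D" "|D| <o |A|" "infinite A"
  shows "|A| \<le>o |X|"
proof (rule ccontr)
  assume "\<not> |A| \<le>o |X|"
  then have "|X| <o |A|" by (simp add: not_card_of_le_iff)
  then have "|X \<union> D| <o |A|" using assms card_of_Un_ordLess_infinite by blast
  then show False using card_of_mono1[OF assms(1)] not_ordLeq_ordLess by blast
qed

lemma card_of_UN_finite_less:
  assumes "finite I" "infinite K" "\<And>i. i \<in> I \<Longrightarrow> |f i| <o |K|"
  shows "|\<Union>(f ` I)| <o |K|"
  using assms(1,3)
proof (induction I rule: finite_induct)
  case empty
  show ?case using card_of_finite_less_infinite[of "{}" K] assms(2) by simp
next
  case (insert i I)
  have "|f i \<union> \<Union>(f ` I)| <o |K|"
    by (rule card_of_Un_ordLess_infinite[OF assms(2)]) (use insert in auto)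
  then show ?case by simp
qed

text \<open>Friends and opponents together make up \<open>N\<close>, so the larger of the two
  classes has the cardinality of \<open>N\<close>; for a happy vertex the opponents are such a
  class.\<close>

lemma content_infinite_iff:
  assumes "infinite N"
  shows "content N p x \<longleftrightarrow> |N| \<le>o |{y \<in> N. p y \<noteq> p x}|"
proof
  assume c: "content N p x"
  show "|N| \<le>o |{y \<in> N. p y \<noteq> p x}|"
  proof (rule ccontr)
    assume "\<not> ?thesis"
    then have o: "|{y \<in> N. p y \<noteq> p x}| <o |N|" by (simp add: not_card_of_le_iff)
    then have "|{y \<in> N. p y = p x}| <o |N|" using ordLeq_ordLess_trans[OF _ o] c unfolding content_def by simp
    moreover have "|N| \<le>o |{y \<in> N. p y = p x}|"
      by (rule card_of_le_if_subset_Un[OF _ o assms]) auto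
    ultimately show False by (simp add: not_ordLeq_ordLess)
  qed
next
  assume "|N| \<le>o |{y \<in> N. p y \<noteq> p x}|"
  moreover have "|{y \<in> N. p y = p x}| \<le>o |N|" by (rule card_of_mono1) auto
  ultimately show "content N p x" unfolding content_def by (rule ordLeq_transitive[rotated])
qed

lemma content_if_many_opponents:
  assumes "infinite N" "X \<subseteq> N" "|N| \<le>o |{y \<in> X. p y \<noteq> p x}|"
  shows "content N p x"
proof -
  have "|{y \<in> X. p y \<noteq> p x}| \<le>o |{y \<in> N. p y \<noteq> p x}|" using assms(2) by (intro card_of_mono1) auto
  then show ?thesis using ordLeq_transitive[OF assms(3)] content_infinite_iff[OF assms(1)] by blast
qed

text \<open>A happy vertex of infinite degree has as many opponents as neighbours, so fewer changes
  than that cannot make it unhappy. The recolouring arguments below rest on this.\<close>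

lemma content_small_change:
  assumes "infinite N" "content N p x" "q x = p x" "\<And>y. y \<in> N \<Longrightarrow> q y \<noteq> p y \<Longrightarrow> y \<in> D" "|D| <o |N|"
  shows "content N q x"
proof -
  let ?O = "\<lambda>p. {y \<in> N. p y \<noteq> p x}"
  have p: "|N| \<le>o |?O p|" using assms(2) content_infinite_iff[OF assms(1)] by simp
  have inf: "infinite (?O p)" using card_of_ordLeq_finite[OF p] assms(1) by blast
  have "|D| <o |?O p|" using ordLess_ordLeq_trans[OF assms(5) p] .
  moreover have "?O p \<subseteq> ?O q \<union> D" using assms(3,4) by auto
  ultimately have "|?O p| \<le>o |?O q|" using inf card_of_le_if_subset_Un by blast
  then show ?thesis using ordLeq_transitive[OF p] content_infinite_iff[OF assms(1)] by blast
qed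

text \<open>Reachability proceeds in countably many levels, each of size at most
  \<open>|L|\<close>.\<close>

lemma card_of_rtranclp_image:
  assumes inf: "infinite L" and T: "|T| \<le>o |L|" and r: "\<And>x. |{y. r x y}| \<le>o |L|"
  shows "|{y. \<exists>t\<in>T. r\<^sup>*\<^sup>* t y}| \<le>o |L|"
proof -
  define Z where "Z n = {y. \<exists>t\<in>T. (r ^^ n) t y}" for n
  have Z: "|Z n| \<le>o |L|" for n
  proof (induction n)
    case 0
    have "Z 0 = T" by (auto simp: Z_def)
    then show ?case using T by simp
  next
    case (Suc n)
    have "Z (Suc n) = (\<Union>x\<in>Z n. {y. r x y})" by (auto simp: Z_def)
    then show ?case using card_of_UNION_ordLeq_infinite[OF inf Suc, of "\<lambda>x. {y. r x y}"] r by simp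
  qed
  have "{y. \<exists>t\<in>T. r\<^sup>*\<^sup>* t y} = (\<Union>n\<in>(UNIV::nat set). Z n)"
    by (auto simp: Z_def rtranclp_power)
  moreover have "|UNIV::nat set| \<le>o |L|" using inf infinite_iff_card_of_nat by blast
  ultimately show ?thesis using card_of_UNION_ordLeq_infinite[OF inf, of UNIV Z] Z by simp
qed

text \<open>By Zorn's lemma. In this form of maximality, a member of \<B> that avoids all chosen
  sets is itself chosen and therefore empty.\<close>

lemma ex_maximal_disjoint_subfamily:
  "\<exists>\<D>\<subseteq>\<B>. pairwise disjnt \<D> \<and> (\<forall>D\<in>\<B>. (\<forall>D'\<in>\<D>. disjnt D D') \<longrightarrow> D \<in> \<D>)"
proof -
  define \<A> where "\<A> = {\<D>. \<D> \<subseteq> \<B> \<and> pairwise disjnt \<D>}"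
  have "\<exists>M\<in>\<A>. \<forall>X\<in>\<A>. M \<subseteq> X \<longrightarrow> X = M"
  proof (rule subset_Zorn)
    fix C assume C: "subset.chain \<A> C"
    have "pairwise disjnt (\<Union>C)"
      unfolding pairwise_def
    proof (intro ballI impI)
      fix x y assume "x \<in> \<Union>C" "y \<in> \<Union>C" "x \<noteq> y"
      then obtain X Y where XY: "X \<in> C" "Y \<in> C" "x \<in> X" "y \<in> Y" by auto
      then have "X \<subseteq> Y \<or> Y \<subseteq> X" using C by (meson subset.chain_def subset_chain_def)
      moreover have "pairwise disjnt X" "pairwise disjnt Y"
        using C XY by (auto simp: subset_chain_def \<A>_def)
      ultimately show "disjnt x y" using XY \<open>x \<noteq> y\<close> unfolding pairwise_def by blast
    qed
    moreover have "\<Union>C \<subseteq> \<B>" using C by (auto simp: subset_chain_def \<A>_def)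
    ultimately have "\<Union>C \<in> \<A>" by (simp add: \<A>_def)
    then show "\<exists>U\<in>\<A>. \<forall>X\<in>C. X \<subseteq> U" by blast
  qed
  then obtain M where M: "M \<in> \<A>" "\<And>X. X \<in> \<A> \<Longrightarrow> M \<subseteq> X \<Longrightarrow> X = M" by blast
  have "D \<in> M" if D: "D \<in> \<B>" "\<forall>D'\<in>M. disjnt D D'" for D
  proof -
    have "insert D M \<in> \<A>" using M(1) D by (auto simp: \<A>_def pairwise_insert disjnt_sym)
    then show ?thesis using M(2) by blast
  qed
  then show ?thesis using M(1) unfolding \<A>_def by (intro exI[of _ M]) auto
qed

section \<open>Pre-partitionable vertex sets\<close>

locale graph_relation =
  fixes E :: "'a \<Rightarrow> 'a \<Rightarrow> bool"
  assumes E_sym: "E x y \<Longrightarrow> E y x" and E_irrefl: "\<not> E x x"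
begin

definition nb :: "'a \<Rightarrow> 'a set" where "nb x = {y. E x y}"

text \<open>\<open>R\<close> is the set of free vertices, that is, the complement of the domain of the given partition.\<close>

definition extends_happily :: "'a set \<Rightarrow> 'a set \<Rightarrow> ('a \<Rightarrow> bool) \<Rightarrow> ('a \<Rightarrow> bool) \<Rightarrow> bool" where
  "extends_happily W R p q \<longleftrightarrow> (\<forall>x. x \<notin> R \<longrightarrow> q x = p x) \<and> (\<forall>x\<in>R. content (nb x \<inter> W) q x)"

definition pre_part :: "'a set \<Rightarrow> bool" where
  "pre_part W \<longleftrightarrow> (\<forall>R\<subseteq>W. \<forall>p. \<exists>q. extends_happily W R p q)"

text \<open>Among the extensions of \<open>p\<close>, one with the most bichromatic edges works:
  flipping an unhappy free vertex would produce more of them.\<close>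

lemma pre_part_finite:
  assumes fin: "finite W"
  shows "pre_part W"
  unfolding pre_part_def
proof (intro allI impI)
  fix R and p :: "'a \<Rightarrow> bool" assume R: "R \<subseteq> W"
  \<comment> \<open>Unordered pairs count each edge once, and \<open>Pow W\<close> bounds all cuts,
    so that a maximum exists.\<close>
  define cut where "cut q = {{a, b} | a b. a \<in> W \<and> b \<in> W \<and> E a b \<and> q a \<noteq> q b}" for q :: "'a \<Rightarrow> bool"
  have fc: "finite (cut q)" "card (cut q) \<le> card (Pow W)" for q
  proof -
    have s: "cut q \<subseteq> Pow W" by (auto simp: cut_def)
    show "finite (cut q)" "card (cut q) \<le> card (Pow W)"
      using finite_subset[OF s] card_mono[OF _ s] fin by auto
  qed
  define P where "P (q :: 'a \<Rightarrow> bool) \<longleftrightarrow> (\<forall>x. x \<notin> R \<longrightarrow> q x = p x)" for q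
  have "\<exists>q. P q \<and> (\<forall>q'. P q' \<longrightarrow> card (cut q') \<le> card (cut q))"
    by (rule ex_has_greatest_nat[of P p _ "Suc (card (Pow W))"]) (auto simp: P_def less_Suc_eq_le fc(2))
  then obtain q where q: "P q" "\<And>q'. P q' \<Longrightarrow> card (cut q') \<le> card (cut q)" by blast
  have "content (nb x \<inter> W) q x" if x: "x \<in> R" for x
  proof (rule ccontr)
    assume nc: "\<not> content (nb x \<inter> W) q x"
    define F where "F = {y \<in> nb x \<inter> W. q y = q x}"
    define O' where "O' = {y \<in> nb x \<inter> W. q y \<noteq> q x}"
    have finFO: "finite F" "finite O'" using fin by (auto simp: F_def O'_def)
    have "\<not> |F| \<le>o |O'|" using nc by (simp add: content_def F_def O'_def)
    then have less: "card O' < card F"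
      using finFO by (simp add: card_of_le_iff_card)
    define q' :: "'a \<Rightarrow> bool" where "q' = q(x := \<not> q x)"
    let ?e = "\<lambda>y. {x, y}"
    have inj: "inj ?e" by (auto simp: inj_def doubleton_eq_iff)
    have xW: "x \<in> W" using x R by auto
    \<comment> \<open>Flipping \<open>x\<close> cuts the edges to its former friends and gives up
      only those to its former opponents.\<close>
    have sub: "(cut q - ?e ` O') \<union> ?e ` F \<subseteq> cut q'"
    proof
      fix e assume "e \<in> (cut q - ?e ` O') \<union> ?e ` F"
      then show "e \<in> cut q'"
      proof
        assume "e \<in> ?e ` F"
        then obtain y where "y \<in> F" "e = {x, y}" by auto
        moreover then have "y \<noteq> x" using E_irrefl by (auto simp: F_def nb_def)
        ultimately show ?thesis using xW unfolding cut_def q'_def F_def nb_def by fastforce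
      next
        assume e: "e \<in> cut q - ?e ` O'"
        then obtain a b where ab: "e = {a, b}" "a \<in> W" "b \<in> W" "E a b" "q a \<noteq> q b"
          by (auto simp: cut_def)
        have "a \<noteq> x" using e ab by (auto simp: O'_def nb_def)
        moreover have "b \<noteq> x" using e ab E_sym by (auto simp: O'_def nb_def insert_commute)
        ultimately have "q' a \<noteq> q' b" using ab by (simp add: q'_def)
        then show ?thesis using ab unfolding cut_def by blast
      qed
    qed
    have OC: "?e ` O' \<subseteq> cut q" using xW by (auto simp: cut_def O'_def nb_def)
    have dis: "(cut q - ?e ` O') \<inter> ?e ` F = {}"
    proof (rule ccontr)
      assume "\<not> ?thesis"
      then obtain y where y: "y \<in> F" "{x, y} \<in> cut q" by auto
      then show False by (auto simp: cut_def F_def doubleton_eq_iff)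
    qed
    have "card (cut q) = card (cut q - ?e ` O') + card O'"
      using card_Diff_subset[OF _ OC] card_mono[OF fc(1) OC] finFO inj
      by (simp add: card_image inj_on_subset)
    also have "\<dots> < card (cut q - ?e ` O') + card F" using less by simp
    also have "\<dots> = card ((cut q - ?e ` O') \<union> ?e ` F)"
      using dis fc(1) finFO inj by (subst card_Un_disjoint) (auto simp: card_image inj_on_subset)
    also have "\<dots> \<le> card (cut q')" using card_mono[OF fc(1) sub] .
    finally have "card (cut q) < card (cut q')" .
    moreover have "P q'" using q(1) x by (auto simp: P_def q'_def)
    ultimately show False using q(2) by fastforce
  qed
  then show "\<exists>q. extends_happily W R p q" using q(1) by (auto simp: extends_happily_def P_def)
qed

text \<open>The region \<open>Z\<close> is what is reachable from \<open>T\<close> through vertices of degree at most \<open>|L|\<close>. A vertex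
  outside \<open>Z\<close> has no neighbour in \<open>Z\<close> or has more than \<open>|Z|\<close> neighbours.\<close>

lemma recolouring_region:
  assumes inf: "infinite L" and T: "|T| \<le>o |L|" and nT: "\<And>t. t \<in> T \<Longrightarrow> |nb t \<inter> W| \<le>o |L|"
    and R: "R \<subseteq> W"
  obtains Z where "T \<subseteq> Z" "Z \<subseteq> T \<union> {x \<in> R. |nb x \<inter> W| \<le>o |L| }"
    "\<And>p q x. (\<And>y. y \<notin> Z \<Longrightarrow> q y = p y) \<Longrightarrow> x \<in> R - Z \<Longrightarrow> content (nb x \<inter> W) p x
      \<Longrightarrow> content (nb x \<inter> W) q x"
proof -
  define low where "low = {x \<in> R. |nb x \<inter> W| \<le>o |L| }"
  \<comment> \<open>A step starts in \<open>T \<union> low\<close>, which bounds the number of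
    targets by \<open>|L|\<close>, and ends in \<open>low\<close>.\<close>
  define r where "r x y \<longleftrightarrow> x \<in> T \<union> low \<and> E x y \<and> y \<in> low" for x y
  define Z where "Z = {y. \<exists>t\<in>T. r\<^sup>*\<^sup>* t y}"
  have "|{y. r x y}| \<le>o |L|" for x
  proof (cases "x \<in> T \<union> low")
    case True
    then have "|nb x \<inter> W| \<le>o |L|" using nT by (auto simp: low_def)
    moreover have "|{y. r x y}| \<le>o |nb x \<inter> W|"
      using R by (intro card_of_mono1) (auto simp: r_def nb_def low_def)
    ultimately show ?thesis by (rule ordLeq_transitive[rotated])
  next
    case False
    then have "{y. r x y} = {}" by (simp add: r_def)
    then show ?thesis by (simp only: card_of_empty)
  qed
  then have cZ: "|Z| \<le>o |L|" unfolding Z_def by (rule card_of_rtranclp_image[OF inf T])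
  have TZ: "T \<subseteq> Z" by (auto simp: Z_def)
  have Zlow: "Z \<subseteq> T \<union> low"
  proof
    fix y assume "y \<in> Z"
    then obtain t where "t \<in> T" "r\<^sup>*\<^sup>* t y" by (auto simp: Z_def)
    then show "y \<in> T \<union> low" by (auto simp: r_def elim: rtranclp.cases)
  qed
  have "content (nb x \<inter> W) q x"
    if pq: "\<And>y. y \<notin> Z \<Longrightarrow> q y = p y" and x: "x \<in> R - Z" and c: "content (nb x \<inter> W) p x" for p q x
  proof (cases "x \<in> low")
    case True
    \<comment> \<open>As \<open>x\<close> is low, a neighbour in \<open>Z\<close> would make
      \<open>x\<close> reachable from \<open>T\<close> as well.\<close>
    have "y \<notin> Z" if "y \<in> nb x" for y
    proof
      assume y: "y \<in> Z"
      then have "r y x" using Zlow that True E_sym by (auto simp: r_def nb_def)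
      then have "x \<in> Z" using y by (auto simp: Z_def intro: rtranclp.rtrancl_into_rtrancl)
      then show False using x by simp
    qed
    then show ?thesis using c pq x content_cong[of "nb x \<inter> W" "nb x \<inter> W" p x q] by auto
  next
    case False
    then have "|L| <o |nb x \<inter> W|" using x by (simp add: low_def not_card_of_le_iff)
    then have l: "|Z| <o |nb x \<inter> W|" "infinite (nb x \<inter> W)"
      using ordLeq_ordLess_trans[OF cZ] inf card_of_ordLeq_finite[OF ordLess_imp_ordLeq] by auto
    show ?thesis
      by (rule content_small_change[OF l(2) c _ _ l(1)]) (use pq x in auto)
  qed
  then show ?thesis using that[OF TZ] Zlow unfolding low_def by blast
qed

end

section \<open>Counting neighbours and opponents over families of pieces\<close>

text \<open>One piece for each of \<open>n\<close> chosen points suffices. The infinite case is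
  listed separately because \<open>card\<close> is 0 there.\<close>

lemma finite_subfamily_with_many:
  assumes "infinite (N \<inter> \<Union>Q)"
  obtains D where "D \<subseteq> Q" "finite D" "infinite (N \<inter> \<Union>D) \<or> n \<le> card (N \<inter> \<Union>D)"
proof -
  obtain M where M: "finite M" "card M = n" "M \<subseteq> N \<inter> \<Union>Q"
    using infinite_arbitrarily_large[OF assms] by blast
  then have "\<forall>m\<in>M. \<exists>C\<in>Q. m \<in> C" by blast
  then obtain c where c: "\<And>m. m \<in> M \<Longrightarrow> c m \<in> Q \<and> m \<in> c m" by metis
  have "M \<subseteq> N \<inter> \<Union>(c ` M)" using M c by blast
  then have "infinite (N \<inter> \<Union>(c ` M)) \<or> n \<le> card (N \<inter> \<Union>(c ` M))" using M(2) card_mono by blast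
  then show ?thesis using that[of "c ` M"] M(1) c by blast
qed

text \<open>\<open>M\<close> is less than half as large as \<open>N\<close>, so even if all of
  \<open>M\<close> are opponents, at least a quarter of \<open>N\<close> must be opponents too. The
  factor \<open>{..<4}\<close> allows one inequality for finite and infinite
  \<open>N\<close>.\<close>

lemma many_opponents_in_part:
  assumes c: "content (M \<union> N) g b" and M: "finite M" "M \<inter> N = {}"
    and N: "infinite N \<or> Suc (2 * card M) \<le> card N"
  shows "|N| \<le>o |{y \<in> N. g y \<noteq> g b} \<times> {..<4::nat}|"
proof (cases "finite N")
  case False
  let ?O = "{y \<in> M \<union> N. g y \<noteq> g b}" and ?ON = "{y \<in> N. g y \<noteq> g b}"
  have 1: "|M \<union> N| \<le>o |?O|" using c False content_infinite_iff[of "M \<union> N" g b] by simp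
  have 2: "|N| \<le>o |?O|" by (rule ordLeq_transitive[OF card_of_mono1 1]) simp
  have i: "infinite ?O" using card_of_ordLeq_finite[OF 2] False by blast
  have 3: "|?O| \<le>o |?ON|"
    by (rule card_of_le_if_subset_Un[OF _ card_of_finite_less_infinite[OF M(1) i] i]) auto
  have 4: "|?ON| \<le>o |?ON \<times> {..<4::nat}|" by (rule card_of_Times1) (simp add: lessThan_empty_iff)
  show ?thesis by (rule ordLeq_transitive[OF 2 ordLeq_transitive[OF 3 4]])
next
  case True
  let ?fr = "\<lambda>X. {y \<in> X. g y = g b}" and ?op = "\<lambda>X. {y \<in> X. g y \<noteq> g b}"
  have le: "card (?fr (M \<union> N)) \<le> card (?op (M \<union> N))"
    using c True M(1) by (simp add: content_def card_of_le_iff_card)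
  have "card (?fr N) \<le> card (?fr (M \<union> N))" using True M(1) by (intro card_mono) auto
  moreover have "card (?op (M \<union> N)) \<le> card (M \<union> ?op N)" using True M(1) by (intro card_mono) auto
  moreover have "card (M \<union> ?op N) \<le> card M + card (?op N)" by (rule card_Un_le)
  moreover have "card N = card (?fr N) + card (?op N)"
    using True by (subst card_Un_disjoint[symmetric]) (auto intro: arg_cong[where f = card])
  ultimately have "card N \<le> 4 * card (?op N)" using le N True by linarith
  then show ?thesis using True by (subst card_of_le_iff_card) (auto simp: card_cartesian_product)
qed

text \<open>Sums the inequalities of all blocks; \<open>snd\<close> is injective on the disjoint sum
  because the sets \<open>h D\<close> are disjoint.\<close>

lemma card_of_UN_le_disjoint_Times:
  assumes le: "\<And>D. D \<in> \<D> \<Longrightarrow> |f D| \<le>o |h D \<times> I|"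
    and disj: "\<And>D D'. D \<in> \<D> \<Longrightarrow> D' \<in> \<D> \<Longrightarrow> D \<noteq> D' \<Longrightarrow> h D \<inter> h D' = {}"
  shows "|\<Union>(f ` \<D>)| \<le>o |\<Union>(h ` \<D>) \<times> I|"
proof -
  have 1: "|\<Union>(f ` \<D>)| \<le>o |SIGMA D:\<D>. f D|" by (rule card_of_UNION_Sigma)
  have 2: "|SIGMA D:\<D>. f D| \<le>o |SIGMA D:\<D>. h D \<times> I|" using le by (intro card_of_Sigma_mono1) blast
  have "inj_on snd (SIGMA D:\<D>. h D \<times> I)" using disj by (auto simp: inj_on_def)
  then have 3: "|SIGMA D:\<D>. h D \<times> I| \<le>o |\<Union>(h ` \<D>) \<times> I|"
    unfolding card_of_ordLeq[symmetric] by (intro exI[of _ snd]) auto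
  show ?thesis by (rule ordLeq_transitive[OF 1 ordLeq_transitive[OF 2 3]])
qed

text \<open>Removes the factor 4 again once the total is infinite.\<close>

lemma card_of_le_Times_finite:
  assumes "|N| \<le>o |X \<times> I|" "infinite N" "finite I"
  shows "|N| \<le>o |X|"
proof -
  have i: "infinite (X \<times> I)" using assms card_of_ordLeq_finite by blast
  then have X: "infinite X" "I \<noteq> {}" using assms(3) by auto
  have "|X \<times> I| =o |X|"
    using card_of_Times_infinite[OF X ordLess_imp_ordLeq[OF card_of_finite_less_infinite[OF assms(3) X(1)]]]
    by simp
  then show ?thesis using assms(1) ordLeq_ordIso_trans by blast
qed

context graph_relation
begin

section \<open>Finite separators\<close>

text \<open>The pieces need not be connected. Within \<open>S \<union> \<Union>P\<close>, a vertex
  of a piece sees only \<open>S\<close> and its own piece.\<close>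

definition separated :: "'a set \<Rightarrow> 'a set set \<Rightarrow> bool" where
  "separated S P \<longleftrightarrow> finite S \<and> (\<forall>C\<in>P. C \<inter> S = {}) \<and> pairwise disjnt P \<and>
    (\<forall>C\<in>P. \<forall>D\<in>P. C \<noteq> D \<longrightarrow> (\<forall>x\<in>C. \<forall>y\<in>D. \<not> E x y))"

definition decomp :: "'a set \<Rightarrow> 'a set set \<Rightarrow> bool" where
  "decomp S P \<longleftrightarrow> separated S P \<and>
    (\<forall>F T. F \<subseteq> P \<longrightarrow> finite F \<longrightarrow> T \<subseteq> S \<longrightarrow> pre_part (T \<union> \<Union>F))"

lemma decompD:
  assumes "decomp S P"
  shows "finite S" "C \<in> P \<Longrightarrow> C \<inter> S = {}"
    "C \<in> P \<Longrightarrow> D \<in> P \<Longrightarrow> x \<in> C \<Longrightarrow> x \<in> D \<Longrightarrow> C = D"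
    "C \<in> P \<Longrightarrow> D \<in> P \<Longrightarrow> C \<noteq> D \<Longrightarrow> x \<in> C \<Longrightarrow> y \<in> D \<Longrightarrow> \<not> E x y"
    "F \<subseteq> P \<Longrightarrow> finite F \<Longrightarrow> T \<subseteq> S \<Longrightarrow> pre_part (T \<union> \<Union>F)"
proof -
  show "finite S" "C \<in> P \<Longrightarrow> C \<inter> S = {}" "F \<subseteq> P \<Longrightarrow> finite F \<Longrightarrow> T \<subseteq> S \<Longrightarrow> pre_part (T \<union> \<Union>F)"
    using assms by (simp_all add: decomp_def separated_def)
  show "C \<in> P \<Longrightarrow> D \<in> P \<Longrightarrow> C \<noteq> D \<Longrightarrow> x \<in> C \<Longrightarrow> y \<in> D \<Longrightarrow> \<not> E x y"
    using assms by (simp add: decomp_def separated_def)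
  have "pairwise disjnt P" using assms by (simp add: decomp_def separated_def)
  then show "C \<in> P \<Longrightarrow> D \<in> P \<Longrightarrow> x \<in> C \<Longrightarrow> x \<in> D \<Longrightarrow> C = D"
    unfolding pairwise_def disjnt_def by blast
qed

lemma decomp_subfamily: "decomp S P \<Longrightarrow> F \<subseteq> P \<Longrightarrow> decomp S F"
  unfolding decomp_def separated_def by (meson pairwise_subset subset_iff subset_trans)

lemma nb_piece:
  assumes "decomp S P" "C \<in> P" "x \<in> C"
  shows "nb x \<inter> (S \<union> \<Union>P) = nb x \<inter> (S \<union> C)"
  using assms decompD(4)[OF assms(1,2)] by (auto simp: nb_def)

lemma nb_piece_subfamily:
  assumes "decomp S P" "F \<subseteq> P" "C \<in> F" "x \<in> C"
  shows "nb x \<inter> (S \<union> \<Union>F) = nb x \<inter> (S \<union> \<Union>P)"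
  using nb_piece[OF assms(1) subsetD[OF assms(2,3)] assms(4)]
    nb_piece[OF decomp_subfamily[OF assms(1,2)] assms(3,4)] by simp

text \<open>The happiness of a vertex in a piece depends only on the colours of \<open>S\<close> and
  of that piece, so colourings of the pieces that agree on \<open>S\<close> can be combined
  freely.\<close>

lemma glue_pieces:
  assumes d: "decomp S P"
    and gS: "\<And>C x. C \<in> P \<Longrightarrow> x \<in> S \<Longrightarrow> g C x = p x"
    and gR: "\<And>C x. C \<in> P \<Longrightarrow> x \<in> C - R \<Longrightarrow> g C x = p x"
    and gh: "\<And>C x. C \<in> P \<Longrightarrow> x \<in> R \<inter> C \<Longrightarrow> content (nb x \<inter> (S \<union> C)) (g C) x"
  obtains q where "\<And>x. x \<notin> R \<inter> \<Union>P \<Longrightarrow> q x = p x" "\<And>C x. C \<in> P \<Longrightarrow> x \<in> C \<Longrightarrow> q x = g C x"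
    "\<And>x. x \<in> R \<inter> \<Union>P \<Longrightarrow> content (nb x \<inter> (S \<union> \<Union>P)) q x"
proof -
  define q where "q x = (if x \<in> \<Union>P then g (THE C. C \<in> P \<and> x \<in> C) x else p x)" for x
  have q: "q x = g C x" if "C \<in> P" "x \<in> C" for C x
  proof -
    have "(THE C. C \<in> P \<and> x \<in> C) = C" using that decompD(3)[OF d] by (intro the_equality) auto
    then show ?thesis using that by (auto simp: q_def)
  qed
  have qS: "q x = p x" if "x \<in> S" for x using that decompD(2)[OF d] by (auto simp: q_def)
  have "content (nb x \<inter> (S \<union> \<Union>P)) q x" if x: "x \<in> R \<inter> \<Union>P" for x
  proof -
    obtain C where C: "C \<in> P" "x \<in> C" using x by auto
    have "content (nb x \<inter> (S \<union> \<Union>P)) q x \<longleftrightarrow> content (nb x \<inter> (S \<union> C)) (g C) x"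
      using nb_piece[OF d C] q[OF C(1)] qS gS[OF C(1)] C(2) by (intro content_cong) auto
    then show ?thesis using gh C x by blast
  qed
  moreover have "q x = p x" if "x \<notin> R \<inter> \<Union>P" for x
  proof (cases "x \<in> \<Union>P")
    case True
    then obtain C where "C \<in> P" "x \<in> C" by blast
    then show ?thesis using q gR that by auto
  qed (simp add: q_def)
  ultimately show ?thesis using that q by blast
qed

text \<open>Once the colours on \<open>S\<close> are fixed, the pieces do not influence each other,
  and each is handled by \<open>pre_part (S \<union> C)\<close>.\<close>

lemma extends_if_kernel_fixed:
  assumes d: "decomp S P" and R: "R \<subseteq> \<Union>P"
  shows "\<exists>q. extends_happily (S \<union> \<Union>P) R p q"
proof -
  have "\<exists>q. extends_happily (S \<union> C) (R \<inter> C) p q" if "C \<in> P" for C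
  proof -
    have "pre_part (S \<union> C)" using decompD(5)[OF d, of "{C}" S] that by simp
    moreover have "R \<inter> C \<subseteq> S \<union> C" by auto
    ultimately show ?thesis unfolding pre_part_def by blast
  qed
  then obtain g where g: "\<And>C. C \<in> P \<Longrightarrow> extends_happily (S \<union> C) (R \<inter> C) p (g C)" by metis
  obtain q where q: "\<And>x. x \<notin> R \<inter> \<Union>P \<Longrightarrow> q x = p x"
    "\<And>x. x \<in> R \<inter> \<Union>P \<Longrightarrow> content (nb x \<inter> (S \<union> \<Union>P)) q x"
  proof (rule glue_pieces[OF d, of g p R])
    show "g C x = p x" if "C \<in> P" "x \<in> S" for C x
      using g[OF that(1)] decompD(2)[OF d that(1)] that(2) by (auto simp: extends_happily_def)
    show "g C x = p x" if "C \<in> P" "x \<in> C - R" for C x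
      using g[OF that(1)] that by (auto simp: extends_happily_def)
    show "content (nb x \<inter> (S \<union> C)) (g C) x" if "C \<in> P" "x \<in> R \<inter> C" for C x
      using g[OF that(1)] that by (auto simp: extends_happily_def)
  qed (rule that)
  have "R \<inter> \<Union>P = R" using R by blast
  then show ?thesis using q unfolding extends_happily_def by (intro exI[of _ q]) simp
qed

text \<open>The pieces outside \<open>F\<close> are coloured with \<open>S\<close> and
  \<open>\<Union>F\<close> held fixed; the vertices in \<open>\<Union>F\<close> have no neighbours
  among the changed ones.\<close>

lemma extends_from_subfamily:
  assumes d: "decomp S P" and F: "F \<subseteq> P"
    and c: "\<And>x. x \<in> R \<inter> \<Union>F \<Longrightarrow> content (nb x \<inter> (S \<union> \<Union>F)) p x"
  obtains q where "\<And>x. x \<notin> R \<inter> \<Union>(P - F) \<Longrightarrow> q x = p x"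
    "\<And>x. x \<in> R \<inter> \<Union>P \<Longrightarrow> content (nb x \<inter> (S \<union> \<Union>P)) q x"
proof -
  obtain q where q: "extends_happily (S \<union> \<Union>P) (R \<inter> \<Union>(P - F)) p q"
    using extends_if_kernel_fixed[OF d, of "R \<inter> \<Union>(P - F)" p] by blast
  have "content (nb x \<inter> (S \<union> \<Union>P)) q x" if x: "x \<in> R \<inter> \<Union>P" for x
  proof (cases "x \<in> \<Union>(P - F)")
    case True
    then show ?thesis using q x by (simp add: extends_happily_def)
  next
    case False
    then obtain C where C: "C \<in> F" "x \<in> C" using x by blast
    have "q y = p y" if "y \<in> S \<union> C" for y
    proof -
      have "y \<notin> \<Union>(P - F)" using that C F decompD(2,3)[OF d] by blast
      then show ?thesis using q by (simp add: extends_happily_def)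
    qed
    moreover have "nb x \<inter> (S \<union> \<Union>P) = nb x \<inter> (S \<union> C)" using nb_piece[OF d] C F by blast
    ultimately have "content (nb x \<inter> (S \<union> \<Union>P)) q x \<longleftrightarrow> content (nb x \<inter> (S \<union> \<Union>F)) p x"
      using C nb_piece_subfamily[OF d F C] by (intro content_cong) auto
    then show ?thesis using c[of x] x C by blast
  qed
  then show ?thesis using that q unfolding extends_happily_def by blast
qed


text \<open>The finite family \<open>F0\<close> takes care of the vertices in \<open>A\<close> and is part of every block; the vertices in
  \<open>B\<close> get their opponents from many blocks that agree on \<open>S\<close>.\<close>

lemma extends_by_blocks:
  fixes small :: "'a set set \<Rightarrow> bool"
  assumes d: "decomp S P" and R: "R \<subseteq> S \<union> \<Union>P" and F0: "F0 \<subseteq> P" "finite F0"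
    and AB: "R \<inter> S = A \<union> B" and Bne: "B \<noteq> {}"
    and A: "\<And>a. a \<in> A \<Longrightarrow> infinite (nb a \<inter> \<Union>F0)"
      "\<And>a. a \<in> A \<Longrightarrow> |nb a \<inter> (S \<union> \<Union>P)| \<le>o |nb a \<inter> \<Union>F0|"
    and B: "\<And>b. b \<in> B \<Longrightarrow> infinite (nb b \<inter> (S \<union> \<Union>P))" "\<And>b. b \<in> B \<Longrightarrow> finite (nb b \<inter> \<Union>F0)"
    and small: "small {}" "small F0" "\<And>X Y. small X \<Longrightarrow> small Y \<Longrightarrow> small (X \<union> Y)"
      "\<And>I b. small I \<Longrightarrow> b \<in> B \<Longrightarrow> infinite (nb b \<inter> \<Union>(P - I))"
    and big: "\<And>\<D> b. pairwise disjnt \<D> \<Longrightarrow> \<forall>D\<in>\<D>. D \<subseteq> P \<and> finite D \<and> nb b \<inter> \<Union>D \<noteq> {} \<Longrightarrow>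
      \<not> small (\<Union>\<D>) \<Longrightarrow> b \<in> B \<Longrightarrow> |nb b \<inter> (S \<union> \<Union>P)| \<le>o |nb b \<inter> \<Union>(\<Union>\<D>)|"
  shows "\<exists>q. extends_happily (S \<union> \<Union>P) R p q"
proof -
  \<comment> \<open>The pattern \<tau> on \<open>S\<close> is a parameter because only blocks with
    the same pattern can be glued. For \<open>B\<close> only opponents inside \<open>D\<close> are
    counted, since these are added up over disjoint blocks.\<close>
  define block where "block \<tau> D g \<longleftrightarrow> D \<subseteq> P - F0 \<and> finite D \<and> (\<forall>s\<in>S. g s \<longleftrightarrow> s \<in> \<tau>) \<and>
      (\<forall>x. x \<notin> R \<longrightarrow> g x = p x) \<and>
      (\<forall>C\<in>F0 \<union> D. \<forall>x\<in>R \<inter> C. content (nb x \<inter> (S \<union> C)) g x) \<and>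
      (\<forall>a\<in>A. |nb a \<inter> (S \<union> \<Union>P)| \<le>o |{y \<in> nb a \<inter> \<Union>(F0 \<union> D). g y \<noteq> g a}| ) \<and>
      (\<forall>b\<in>B. nb b \<inter> \<Union>D \<noteq> {} \<and>
        |nb b \<inter> \<Union>D| \<le>o |{y \<in> nb b \<inter> \<Union>D. g y \<noteq> g b} \<times> {..<4::nat}| )" for \<tau> D g
  have finS: "finite S" using decompD(1)[OF d] .
  have ABS: "A \<subseteq> R" "B \<subseteq> R" "A \<subseteq> S" "B \<subseteq> S"
    using Un_upper1[of A B] Un_upper2[of B A] unfolding AB[symmetric] by simp_all
  have finB: "finite B" using finS ABS(4) finite_subset by blast
  have ex_block: "\<exists>\<tau> D g. \<tau> \<subseteq> S \<and> block \<tau> D g \<and> D \<inter> I = {}" if I: "small I" for I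
  proof -
    \<comment> \<open>\<open>M b\<close> is the part of the neighbourhood outside the new pieces.
      With more than \<open>2 * card (M b)\<close> neighbours in \<open>D\<close>,
      \<open>many_opponents_in_part\<close> applies.\<close>
    define M where "M b = nb b \<inter> (S \<union> \<Union>F0)" for b
    have finM: "finite (M b)" if "b \<in> B" for b
      using B(2)[OF that] finS by (simp add: M_def Int_Un_distrib)
    have "\<exists>D. D \<subseteq> P - (F0 \<union> I) \<and> finite D \<and>
        (infinite (nb b \<inter> \<Union>D) \<or> Suc (2 * card (M b)) \<le> card (nb b \<inter> \<Union>D))" if "b \<in> B" for b
      using finite_subfamily_with_many[OF small(4)[OF small(3)[OF small(2) I] that]] by metis
    then obtain e where e: "\<And>b. b \<in> B \<Longrightarrow> e b \<subseteq> P - (F0 \<union> I)" "\<And>b. b \<in> B \<Longrightarrow> finite (e b)"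
      "\<And>b. b \<in> B \<Longrightarrow> infinite (nb b \<inter> \<Union>(e b)) \<or> Suc (2 * card (M b)) \<le> card (nb b \<inter> \<Union>(e b))" by metis
    define D where "D = \<Union>(e ` B)"
    have D: "D \<subseteq> P - F0" "D \<inter> I = {}" "finite D" using e finB by (auto simp: D_def)
    have many: "infinite (nb b \<inter> \<Union>D) \<or> Suc (2 * card (M b)) \<le> card (nb b \<inter> \<Union>D)" if b: "b \<in> B" for b
    proof (cases "finite (nb b \<inter> \<Union>D)")
      case True
      have sub: "nb b \<inter> \<Union>(e b) \<subseteq> nb b \<inter> \<Union>D" using b by (auto simp: D_def)
      then have "card (nb b \<inter> \<Union>(e b)) \<le> card (nb b \<inter> \<Union>D)" using True by (rule card_mono[rotated])
      then show ?thesis using e(3)[OF b] finite_subset[OF sub True] by simp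
    qed simp
    define H where "H = F0 \<union> D"
    have H: "H \<subseteq> P" "finite H" using D F0 by (auto simp: H_def)
    define RH where "RH = R \<inter> (S \<union> \<Union>H)"
    have "pre_part (S \<union> \<Union>H)" using decompD(5)[OF d H] by simp
    then obtain g where g: "extends_happily (S \<union> \<Union>H) RH p g"
      unfolding pre_part_def RH_def by (metis Int_lower2)
    have gp: "g x = p x" if "x \<notin> R" for x using that g by (simp add: extends_happily_def RH_def)
    have gc: "content (nb x \<inter> (S \<union> \<Union>H)) g x" if "x \<in> R" "x \<in> S \<union> \<Union>H" for x
      using that g by (simp add: extends_happily_def RH_def)
    \<comment> \<open>The pattern is not prescribed but read off the happy colouring
      \<open>g\<close> of the finite union.\<close>
    have "block {s \<in> S. g s} D g"
      unfolding block_def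
    proof (intro conjI ballI allI impI)
      show "D \<subseteq> P - F0" "finite D" using D by auto
      show "g x = p x" if "x \<notin> R" for x using gp[OF that] .
      show "content (nb x \<inter> (S \<union> C)) g x" if "C \<in> F0 \<union> D" "x \<in> R \<inter> C" for C x
      proof -
        have "nb x \<inter> (S \<union> \<Union>H) = nb x \<inter> (S \<union> C)"
          using nb_piece[OF decomp_subfamily[OF d H(1)], of C x] that by (simp add: H_def)
        moreover have "x \<in> S \<union> \<Union>H" using that by (auto simp: H_def)
        ultimately show ?thesis using gc[of x] that by simp
      qed
      show "|nb a \<inter> (S \<union> \<Union>P)| \<le>o |{y \<in> nb a \<inter> \<Union>(F0 \<union> D). g y \<noteq> g a}|" if a: "a \<in> A" for a
      proof -
        let ?N = "nb a \<inter> (S \<union> \<Union>H)"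
        let ?O = "{y \<in> ?N. g y \<noteq> g a}" and ?OH = "{y \<in> nb a \<inter> \<Union>H. g y \<noteq> g a}"
        have sub: "nb a \<inter> \<Union>F0 \<subseteq> ?N" by (auto simp: H_def)
        have inf: "infinite ?N" using A(1)[OF a] sub infinite_super by blast
        have c: "content ?N g a" using gc[of a] a ABS by blast
        have 1: "|?N| \<le>o |?O|" using c content_infinite_iff[OF inf] by simp
        have 2: "|nb a \<inter> (S \<union> \<Union>P)| \<le>o |?O|"
          by (rule ordLeq_transitive[OF A(2)[OF a] ordLeq_transitive[OF card_of_mono1[OF sub] 1]])
        have i: "infinite ?O" using card_of_ordLeq_finite[OF 1] inf by blast
        have "|?O| \<le>o |?OH|"
          by (rule card_of_le_if_subset_Un[OF _ card_of_finite_less_infinite[OF finS i] i]) auto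
        then show ?thesis using ordLeq_transitive[OF 2] by (simp add: H_def)
      qed
      fix b assume b: "b \<in> B"
      show "nb b \<inter> \<Union>D \<noteq> {}" using many[OF b] by auto
      have "nb b \<inter> (S \<union> \<Union>H) = M b \<union> (nb b \<inter> \<Union>D)" by (auto simp: M_def H_def)
      moreover have "content (nb b \<inter> (S \<union> \<Union>H)) g b" using gc[of b] b ABS by blast
      moreover have "M b \<inter> (nb b \<inter> \<Union>D) = {}"
      proof (rule ccontr)
        assume "\<not> ?thesis"
        then obtain y C where y: "y \<in> S \<union> \<Union>F0" "y \<in> C" "C \<in> D" unfolding M_def by blast
        then have "y \<in> \<Union>F0" using decompD(2)[OF d, of C] D(1) by blast
        then obtain C' where "C' \<in> F0" "y \<in> C'" by blast
        then show False using decompD(3)[OF d, of C C' y] y D(1) F0(1) by blast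
      qed
      ultimately show "|nb b \<inter> \<Union>D| \<le>o |{y \<in> nb b \<inter> \<Union>D. g y \<noteq> g b} \<times> {..<4::nat}|"
        using many_opponents_in_part[of "M b" "nb b \<inter> \<Union>D" g b] finM[OF b] many[OF b] by simp
    qed auto
    then show ?thesis using D(2) by (intro exI[of _ "{s \<in> S. g s}"] exI[of _ D] exI[of _ g]) simp
  qed
  define Bl where "Bl \<tau> = {D. \<exists>g. block \<tau> D g}" for \<tau>
  have "\<forall>\<tau>. \<exists>\<D>. \<D> \<subseteq> Bl \<tau> \<and> pairwise disjnt \<D> \<and> (\<forall>D\<in>Bl \<tau>. (\<forall>D'\<in>\<D>. disjnt D D') \<longrightarrow> D \<in> \<D>)"
    by (intro allI ex_maximal_disjoint_subfamily)
  from choice[OF this] obtain \<M> where \<M>: "\<And>\<tau>. \<M> \<tau> \<subseteq> Bl \<tau>" "\<And>\<tau>. pairwise disjnt (\<M> \<tau>)"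
    "\<And>\<tau> D. D \<in> Bl \<tau> \<Longrightarrow> \<forall>D'\<in>\<M> \<tau>. disjnt D D' \<Longrightarrow> D \<in> \<M> \<tau>"
    by auto
  \<comment> \<open>There are finitely many patterns. If all the maximal families were small, so
    would be their union, and a block avoiding it would violate maximality for its own
    pattern.\<close>
  have "\<exists>\<tau>\<subseteq>S. \<not> small (\<Union>(\<M> \<tau>))"
  proof (rule ccontr)
    assume "\<not> ?thesis"
    then have sm: "small (\<Union>(\<M> \<tau>))" if "\<tau> \<in> Pow S" for \<tau> using that by blast
    have "small (\<Union>\<tau>\<in>X. \<Union>(\<M> \<tau>))" if "finite X" "X \<subseteq> Pow S" for X
      using that
    proof (induction X rule: finite_induct)
      case empty
      then show ?case using small(1) by simp
    next
      case (insert \<tau> X)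
      then show ?case using small(3)[OF sm[of \<tau>]] by simp
    qed
    then have "small (\<Union>\<tau>\<in>Pow S. \<Union>(\<M> \<tau>))" using finS by simp
    from ex_block[OF this] obtain \<tau> D g where b: "\<tau> \<subseteq> S" "block \<tau> D g" "D \<inter> (\<Union>\<tau>\<in>Pow S. \<Union>(\<M> \<tau>)) = {}"
      by (elim exE conjE)
    have "\<forall>D'\<in>\<M> \<tau>. disjnt D D'" using b unfolding disjnt_def by blast
    then have "D \<in> \<M> \<tau>" using \<M>(3)[of D \<tau>] b(2) by (auto simp: Bl_def)
    \<comment> \<open>\<open>D\<close> belongs to a family whose union it avoids; but a block
      contains neighbours of every vertex of \<open>B\<close>, and \<open>B\<close> is
      nonempty.\<close>
    then have "D = {}" using b by blast
    then show False using b(2) Bne unfolding block_def by auto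
  qed
  then obtain \<tau> where \<tau>: "\<tau> \<subseteq> S" "\<not> small (\<Union>(\<M> \<tau>))" by blast
  define \<D> where "\<D> = \<M> \<tau>"
  have \<D>: "pairwise disjnt \<D>" "\<not> small (\<Union>\<D>)" using \<M>(2) \<tau>(2) by (auto simp: \<D>_def)
  have "\<forall>D\<in>\<D>. \<exists>g. block \<tau> D g" using \<M>(1)[of \<tau>] by (auto simp: \<D>_def Bl_def)
  then obtain g where g: "\<And>D. D \<in> \<D> \<Longrightarrow> block \<tau> D (g D)" by metis
  have gD: "D \<subseteq> P - F0" "finite D" "\<And>s. s \<in> S \<Longrightarrow> g D s \<longleftrightarrow> s \<in> \<tau>" "\<And>x. x \<notin> R \<Longrightarrow> g D x = p x"
      "\<And>C x. C \<in> F0 \<union> D \<Longrightarrow> x \<in> R \<inter> C \<Longrightarrow> content (nb x \<inter> (S \<union> C)) (g D) x"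
      "\<And>a. a \<in> A \<Longrightarrow> |nb a \<inter> (S \<union> \<Union>P)| \<le>o |{y \<in> nb a \<inter> \<Union>(F0 \<union> D). g D y \<noteq> g D a}|"
      "\<And>b. b \<in> B \<Longrightarrow> nb b \<inter> \<Union>D \<noteq> {}"
      "\<And>b. b \<in> B \<Longrightarrow> |nb b \<inter> \<Union>D| \<le>o |{y \<in> nb b \<inter> \<Union>D. g D y \<noteq> g D b} \<times> {..<4::nat}|"
    if "D \<in> \<D>" for D
    using g[OF that] unfolding block_def by simp_all
  \<comment> \<open>The blocks may colour \<open>F0\<close> differently, so one of them is selected
    to do it. There is one, because the empty family is small.\<close>
  obtain D1 where D1: "D1 \<in> \<D>" using \<D>(2) small(1) by (cases "\<D> = {}") auto
  \<comment> \<open>Imposing \<tau> on \<open>S\<close> changes \<open>p\<close> only on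
    \<open>R\<close>, because the block colourings extend \<open>p\<close> and have this
    pattern.\<close>
  define p' where "p' x = (if x \<in> S then x \<in> \<tau> else p x)" for x
  have p'R: "p' x = p x" if "x \<notin> R" for x using gD(3,4)[OF D1, of x] that by (auto simp: p'_def)
  have D_uniq: "D = D'" if "D \<in> \<D>" "D' \<in> \<D>" "C \<in> D" "C \<in> D'" for D D' C
    using \<D>(1) that unfolding pairwise_def disjnt_def by blast
  define ok where "ok C h \<longleftrightarrow> (\<forall>x\<in>S. h x = p' x) \<and> (\<forall>x\<in>C - R. h x = p' x) \<and>
      (\<forall>x\<in>R \<inter> C. content (nb x \<inter> (S \<union> C)) h x) \<and>
      (\<forall>D\<in>\<D>. C \<in> D \<longrightarrow> h = g D) \<and> (C \<in> F0 \<longrightarrow> h = g D1)" for C h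
  have "\<exists>h. ok C h" if C: "C \<in> P" for C
  proof -
    have gp': "g D x = p' x" if "D \<in> \<D>" "x \<in> S \<or> x \<notin> R" for D x
      using gD(3,4)[OF that(1)] p'R that(2) by (auto simp: p'_def)
    consider "C \<in> F0" | D where "D \<in> \<D>" "C \<in> D" | "C \<notin> F0" "\<forall>D\<in>\<D>. C \<notin> D" by blast
    then show ?thesis
    proof cases
      case 1
      have "C \<notin> D" if "D \<in> \<D>" for D using gD(1)[OF that] 1 by blast
      then show ?thesis using gp'[OF D1] gD(5)[OF D1, of C] 1 unfolding ok_def by (intro exI[of _ "g D1"]) auto
    next
      case 2
      have "C \<notin> F0" using gD(1)[OF 2(1)] 2 by blast
      moreover have "g D = g D'" if "D' \<in> \<D>" "C \<in> D'" for D'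
        using D_uniq[OF 2(1) that(1) 2(2) that(2)] by simp
      moreover have "\<forall>x\<in>S. g D x = p' x" "\<forall>x\<in>C - R. g D x = p' x" using gp'[OF 2(1)] by blast+
      moreover have "\<forall>x\<in>R \<inter> C. content (nb x \<inter> (S \<union> C)) (g D) x" using gD(5)[OF 2(1), of C] 2(2) by blast
      ultimately show ?thesis unfolding ok_def by (intro exI[of _ "g D"] conjI ballI impI) simp_all
    next
      case 3
      \<comment> \<open>Pieces in neither \<open>F0\<close> nor a block are filled in with the
        pattern on \<open>S\<close> kept fixed.\<close>
      have "pre_part (S \<union> C)" using decompD(5)[OF d, of "{C}" S] C by simp
      moreover have "R \<inter> C \<subseteq> S \<union> C" by auto
      ultimately obtain h where "extends_happily (S \<union> C) (R \<inter> C) p' h" unfolding pre_part_def by blast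
      then show ?thesis using 3 decompD(2)[OF d C] unfolding extends_happily_def ok_def
        by (intro exI[of _ h]) auto
    qed
  qed
  then obtain h where "\<And>C. C \<in> P \<Longrightarrow> ok C (h C)" by metis
  then have h: "\<And>C x. C \<in> P \<Longrightarrow> x \<in> S \<Longrightarrow> h C x = p' x"
    "\<And>C x. C \<in> P \<Longrightarrow> x \<in> C - R \<Longrightarrow> h C x = p' x"
    "\<And>C x. C \<in> P \<Longrightarrow> x \<in> R \<inter> C \<Longrightarrow> content (nb x \<inter> (S \<union> C)) (h C) x"
    "\<And>C D. C \<in> P \<Longrightarrow> D \<in> \<D> \<Longrightarrow> C \<in> D \<Longrightarrow> h C = g D" "\<And>C. C \<in> P \<Longrightarrow> C \<in> F0 \<Longrightarrow> h C = g D1"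
    unfolding ok_def by simp_all
  obtain q where q: "\<And>x. x \<notin> R \<inter> \<Union>P \<Longrightarrow> q x = p' x" "\<And>C x. C \<in> P \<Longrightarrow> x \<in> C \<Longrightarrow> q x = h C x"
    "\<And>x. x \<in> R \<inter> \<Union>P \<Longrightarrow> content (nb x \<inter> (S \<union> \<Union>P)) q x"
    by (rule glue_pieces[OF d, of h p' R]) (use h(1-3) in auto)
  have qS: "q s \<longleftrightarrow> s \<in> \<tau>" if "s \<in> S" for s
    using q(1)[of s] that decompD(2)[OF d] by (auto simp: p'_def)
  have qD: "q y = g D y" if "D \<in> \<D>" "y \<in> \<Union>D" for D y
    using that q(2) h(4) gD(1)[OF that(1)] by (metis DiffD1 UnionE subsetD)
  have qF0: "q y = g D1 y" if "y \<in> \<Union>F0" for y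
    using that q(2) h(5) F0(1) by (metis UnionE subsetD)
  have "content (nb x \<inter> (S \<union> \<Union>P)) q x" if x: "x \<in> R" for x
  proof -
    consider "x \<in> R \<inter> \<Union>P" | "x \<in> A" | "x \<in> B" using x R AB by blast
    then show ?thesis
    proof cases
      case 1
      then show ?thesis by (rule q(3))
    next
      case 2
      \<comment> \<open>A vertex of \<open>A\<close> finds all the opponents it needs in
        \<open>F0 \<union> D1\<close>, which is coloured by \<open>g D1\<close> throughout.\<close>
      have "infinite (nb x \<inter> (S \<union> \<Union>P))"
        by (rule infinite_super[OF _ A(1)[OF 2]]) (use F0(1) in auto)
      moreover have "{y \<in> nb x \<inter> \<Union>(F0 \<union> D1). q y \<noteq> q x} = {y \<in> nb x \<inter> \<Union>(F0 \<union> D1). g D1 y \<noteq> g D1 x}"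
        using qF0 qD[OF D1] qS[of x] gD(3)[OF D1, of x] 2 ABS by auto
      ultimately show ?thesis using gD(6)[OF D1 2] F0(1) gD(1)[OF D1]
        by (intro content_if_many_opponents[where X = "nb x \<inter> \<Union>(F0 \<union> D1)"]) auto
    next
      case 3
      let ?O = "\<lambda>D. {y \<in> nb x \<inter> \<Union>D. q y \<noteq> q x}"
      have xS: "x \<in> S" using 3 ABS by blast
      have O: "?O D = {y \<in> nb x \<inter> \<Union>D. g D y \<noteq> g D x}" if "D \<in> \<D>" for D
        using qD[OF that] qS[OF xS] gD(3)[OF that xS] by auto
      \<comment> \<open>By \<open>big\<close> the blocks contain as many neighbours of
        \<open>x\<close> as its whole degree. At least a quarter of those in each block are
        opponents, and the blocks are disjoint.\<close>
      have 1: "|nb x \<inter> (S \<union> \<Union>P)| \<le>o |nb x \<inter> \<Union>(\<Union>\<D>)|"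
        using gD(1,2,7) 3 by (intro big[OF \<D>(1) _ \<D>(2) 3]) blast
      have "|\<Union>((\<lambda>D. nb x \<inter> \<Union>D) ` \<D>)| \<le>o |\<Union>(?O ` \<D>) \<times> {..<4::nat}|"
      proof (rule card_of_UN_le_disjoint_Times)
        show "|nb x \<inter> \<Union>D| \<le>o |?O D \<times> {..<4::nat}|" if "D \<in> \<D>" for D
          using gD(8)[OF that 3] O[OF that] by simp
        show "?O D \<inter> ?O D' = {}" if D: "D \<in> \<D>" "D' \<in> \<D>" "D \<noteq> D'" for D D'
        proof (rule ccontr)
          assume "\<not> ?thesis"
          then obtain y C C' where "C \<in> D" "C' \<in> D'" "y \<in> C" "y \<in> C'" by blast
          moreover then have "C = C'" using decompD(3)[OF d] gD(1)[OF D(1)] gD(1)[OF D(2)] by blast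
          ultimately show False using D_uniq D by blast
        qed
      qed
      moreover have "\<Union>((\<lambda>D. nb x \<inter> \<Union>D) ` \<D>) = nb x \<inter> \<Union>(\<Union>\<D>)" by blast
      ultimately have 2: "|nb x \<inter> (S \<union> \<Union>P)| \<le>o |\<Union>(?O ` \<D>) \<times> {..<4::nat}|"
        using ordLeq_transitive[OF 1] by simp
      have "|nb x \<inter> (S \<union> \<Union>P)| \<le>o |\<Union>(?O ` \<D>)|"
        by (rule card_of_le_Times_finite[OF 2 B(1)[OF 3]]) simp
      moreover have "\<Union>(?O ` \<D>) = {y \<in> nb x \<inter> \<Union>(\<Union>\<D>). q y \<noteq> q x}" by blast
      moreover have "nb x \<inter> \<Union>(\<Union>\<D>) \<subseteq> nb x \<inter> (S \<union> \<Union>P)" using gD(1) by blast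
      ultimately show ?thesis
        by (intro content_if_many_opponents[OF B(1)[OF 3], of "nb x \<inter> \<Union>(\<Union>\<D>)"]) (simp_all only:)
    qed
  qed
  moreover have "q x = p x" if "x \<notin> R" for x using q(1)[of x] p'R[of x] that by simp
  ultimately show ?thesis unfolding extends_happily_def by blast
qed


section \<open>Induction on the number of free separator vertices, by cases on their degrees\<close>

definition solvable_below :: "nat \<Rightarrow> bool" where
  "solvable_below n \<longleftrightarrow> (\<forall>S P R p. decomp S P \<longrightarrow> R \<subseteq> S \<union> \<Union>P \<longrightarrow> card (R \<inter> S) < n \<longrightarrow>
     (\<exists>q. extends_happily (S \<union> \<Union>P) R p q))"

lemma solvable_belowD:
  assumes "solvable_below n" "decomp S P" "R \<subseteq> S \<union> \<Union>P" "card (R \<inter> S) < n"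
  obtains q where "extends_happily (S \<union> \<Union>P) R p q"
  using assms unfolding solvable_below_def by blast

text \<open>Such a \<open>t\<close> sees only finitely many pieces. Merging \<open>t\<close> with
  them into one piece \<open>C0\<close> gives a decomposition with one free separator vertex
  fewer.\<close>

lemma extends_if_finite_degree:
  assumes d: "decomp S P" and R: "R \<subseteq> S \<union> \<Union>P" and sol: "solvable_below (card (R \<inter> S))"
    and t: "t \<in> R \<inter> S" "finite (nb t \<inter> (S \<union> \<Union>P))"
  shows "\<exists>q. extends_happily (S \<union> \<Union>P) R p q"
proof -
  define F where "F = {C \<in> P. nb t \<inter> C \<noteq> {}}"
  have "\<exists>y. y \<in> nb t \<inter> C" if "C \<in> F" for C using that by (auto simp: F_def)
  then obtain c where c: "\<And>C. C \<in> F \<Longrightarrow> c C \<in> nb t \<inter> C" by metis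
  have "inj_on c F"
  proof (rule inj_onI)
    fix C D assume CD: "C \<in> F" "D \<in> F" "c C = c D"
    then show "C = D" using decompD(3)[OF d, of C D "c C"] c[of C] c[of D] by (auto simp: F_def)
  qed
  moreover have "c ` F \<subseteq> nb t \<inter> (S \<union> \<Union>P)" using c by (auto simp: F_def)
  ultimately have finF: "finite F" using t(2) finite_subset finite_imageD by blast
  have FP: "F \<subseteq> P" by (auto simp: F_def)
  have tS: "t \<in> S" using t by simp
  have tP: "t \<notin> C" if "C \<in> P" for C using decompD(2)[OF d that] tS by blast
  define C0 where "C0 = insert t (\<Union>F)"
  define S' where "S' = S - {t}"
  define P' where "P' = insert C0 (P - F)"
  have W: "S' \<union> \<Union>P' = S \<union> \<Union>P"
    using tS FP by (auto simp: S'_def P'_def C0_def)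
  have C0_disj: "C0 \<inter> C = {}" if "C \<in> P - F" for C
    using that tP decompD(3)[OF d] FP unfolding C0_def by blast
  have C0_edge: "\<not> E x y" if C: "C \<in> P - F" and x: "x \<in> C0" and y: "y \<in> C" for C x y
  proof (cases "x = t")
    case True
    then show ?thesis using C y by (auto simp: F_def nb_def)
  next
    case False
    then obtain D where "D \<in> F" "x \<in> D" using x by (auto simp: C0_def)
    then show ?thesis using decompD(4)[OF d, of D C x y] C y FP by blast
  qed
  have d': "decomp S' P'"
    unfolding decomp_def separated_def
  proof (intro conjI ballI allI impI)
    show "finite S'" using decompD(1)[OF d] by (simp add: S'_def)
    show "C \<inter> S' = {}" if "C \<in> P'" for C
      using that decompD(2)[OF d] FP unfolding P'_def C0_def S'_def by blast
    show "pairwise disjnt P'"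
      unfolding P'_def pairwise_insert
    proof (intro conjI allI impI)
      show "pairwise disjnt (P - F)"
        using d by (auto simp: decomp_def separated_def intro: pairwise_subset)
    qed (use C0_disj in \<open>auto simp: disjnt_def\<close>)
    show "\<not> E x y" if CD: "C \<in> P'" "D \<in> P'" "C \<noteq> D" "x \<in> C" "y \<in> D" for C D x y
    proof -
      consider "C = C0" "D \<in> P - F" | "D = C0" "C \<in> P - F" | "C \<in> P" "D \<in> P"
        using CD unfolding P'_def by blast
      then show ?thesis
      proof cases
        case 1
        then show ?thesis using C0_edge[of D x y] CD by blast
      next
        case 2
        then show ?thesis using C0_edge[of C y x] CD E_sym by blast
      next
        case 3
        then show ?thesis using decompD(4)[OF d] CD by blast
      qed
    qed
    fix G T assume G: "G \<subseteq> P'" "finite G" and T: "T \<subseteq> S'"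
    show "pre_part (T \<union> \<Union>G)"
    proof (cases "C0 \<in> G")
      case True
      \<comment> \<open>Unfolding \<open>C0\<close> turns the union into one for the old
        decomposition, with \<open>t\<close> back in the subset of the separator.\<close>
      have "T \<union> \<Union>G = insert t T \<union> \<Union>((G - {C0}) \<union> F)"
        using True by (auto simp: C0_def)
      moreover have "(G - {C0}) \<union> F \<subseteq> P" using G FP by (auto simp: P'_def)
      moreover have "insert t T \<subseteq> S" using T tS by (auto simp: S'_def)
      ultimately show ?thesis
        using decompD(5)[OF d, of "(G - {C0}) \<union> F" "insert t T"] G(2) finF by (simp only: finite_Un finite_Diff)
    next
      case False
      then have "G \<subseteq> P" "T \<subseteq> S" using G T by (auto simp: P'_def S'_def)
      then show ?thesis using decompD(5)[OF d] G(2) by blast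
    qed
  qed
  have "R \<inter> S' \<subset> R \<inter> S" using t by (auto simp: S'_def)
  then have "card (R \<inter> S') < card (R \<inter> S)" using decompD(1)[OF d] by (intro psubset_card_mono) auto
  moreover have "R \<subseteq> S' \<union> \<Union>P'" using R W by simp
  ultimately obtain q where "extends_happily (S' \<union> \<Union>P') R p q"
    using solvable_belowD[OF sol d'] by blast
  then show ?thesis unfolding W by blast
qed

text \<open>The first round leaves the low separator vertices \<open>T\<close> fixed, the second
  recolours a region around them that no vertex of higher degree notices. The induction hypothesis
  covers both rounds: \<open>t\<close> is not free in the first, \<open>s\<close> not in the
  second.\<close>

lemma extends_if_degrees_differ:
  assumes d: "decomp S P" and R: "R \<subseteq> S \<union> \<Union>P" and sol: "solvable_below (card (R \<inter> S))"
    and s: "s \<in> R \<inter> S" and t: "t \<in> R \<inter> S" "infinite (nb t \<inter> (S \<union> \<Union>P))"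
    and less: "|nb t \<inter> (S \<union> \<Union>P)| <o |nb s \<inter> (S \<union> \<Union>P)|"
  shows "\<exists>q. extends_happily (S \<union> \<Union>P) R p q"
proof -
  let ?W = "S \<union> \<Union>P"
  define L where "L = nb t \<inter> ?W"
  define T where "T = {u \<in> R \<inter> S. |nb u \<inter> ?W| \<le>o |L| }"
  have finS: "finite S" by (rule decompD(1)[OF d])
  have tT: "t \<in> T" using t by (simp add: T_def L_def card_of_mono1)
  have sT: "s \<notin> T" using less not_card_of_le_iff by (auto simp: T_def L_def)
  have infL: "infinite L" using t by (simp add: L_def)
  have "finite T" using finS by (simp add: T_def)
  then have cT: "|T| \<le>o |L|" using card_of_finite_less_infinite[OF _ infL] ordLess_imp_ordLeq by blast
  obtain Z where Z: "T \<subseteq> Z" "Z \<subseteq> T \<union> {x \<in> R. |nb x \<inter> ?W| \<le>o |L| }"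
    "\<And>p q x. (\<And>y. y \<notin> Z \<Longrightarrow> q y = p y) \<Longrightarrow> x \<in> R - Z \<Longrightarrow> content (nb x \<inter> ?W) p x
      \<Longrightarrow> content (nb x \<inter> ?W) q x"
    by (rule recolouring_region[OF infL cT _ R]) (auto simp: T_def)
  have ZR: "Z \<subseteq> R" using Z(2) by (auto simp: T_def)
  have sZ: "s \<notin> Z" using Z(2) sT s by (auto simp: T_def)
  have "(R - T) \<inter> S \<subset> R \<inter> S" using tT t by blast
  then have "card ((R - T) \<inter> S) < card (R \<inter> S)" using finS by (intro psubset_card_mono) auto
  then obtain q where q: "extends_happily ?W (R - T) p q"
    using solvable_belowD[OF sol d, of "R - T"] R by blast
  have "Z \<inter> S \<subset> R \<inter> S" using ZR sZ s by blast
  then have "card (Z \<inter> S) < card (R \<inter> S)" using finS by (intro psubset_card_mono) auto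
  then obtain q' where q': "extends_happily ?W Z q q'"
    using solvable_belowD[OF sol d, of Z] R ZR by blast
  have "q' x = p x" if "x \<notin> R" for x
    using that q q' ZR unfolding extends_happily_def by (metis DiffD1 subsetD)
  moreover have "content (nb x \<inter> ?W) q' x" if "x \<in> R" for x
  proof (cases "x \<in> Z")
    case True
    then show ?thesis using q' by (simp add: extends_happily_def)
  next
    case False
    then have "content (nb x \<inter> ?W) q x" using q that Z(1) by (auto simp: extends_happily_def)
    then show ?thesis using Z(3)[of q' q x] q' False that by (simp add: extends_happily_def)
  qed
  ultimately show ?thesis unfolding extends_happily_def by blast
qed

text \<open>\<open>F\<close> divides the free separator vertices into \<open>A\<close>, with
  \<open>|K|\<close> neighbours in \<open>\<Union>F\<close>, and \<open>B\<close>, with fewer. Both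
  classes are nonempty, so each can be treated by the induction hypothesis while the other is
  fixed.\<close>

lemma extends_if_subfamily_splits:
  fixes K :: "'a set"
  assumes d: "decomp S P" and R: "R \<subseteq> S \<union> \<Union>P" and sol: "solvable_below (card (R \<inter> S))"
    and K: "\<And>s. s \<in> R \<inter> S \<Longrightarrow> |nb s \<inter> (S \<union> \<Union>P)| =o |K|" "|UNIV :: nat set| <o |K|"
    and F: "F \<subseteq> P" and a: "a \<in> R \<inter> S" "|K| \<le>o |nb a \<inter> \<Union>F|"
    and b: "b \<in> R \<inter> S" "\<not> |K| \<le>o |nb b \<inter> \<Union>F|"
  shows "\<exists>q. extends_happily (S \<union> \<Union>P) R p q"
proof -
  let ?W = "S \<union> \<Union>P" and ?V = "S \<union> \<Union>F"
  have finS: "finite S" by (rule decompD(1)[OF d])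
  have dF: "decomp S F" by (rule decomp_subfamily[OF d F])
  have infK: "infinite K"
    using card_of_ordLeq_finite[OF ordLess_imp_ordLeq[OF K(2)]] by auto
  define A where "A = {s \<in> R \<inter> S. |K| \<le>o |nb s \<inter> \<Union>F| }"
  define B where "B = {s \<in> R \<inter> S. \<not> |K| \<le>o |nb s \<inter> \<Union>F| }"
  have AB: "A \<union> B = R \<inter> S" "A \<inter> B = {}" "a \<in> A" "b \<in> B" using a b by (auto simp: A_def B_def)
  have infW: "infinite (nb s \<inter> ?W)" if "s \<in> R \<inter> S" for s
    using card_of_ordIso_finite[OF K(1)[OF that]] infK by simp
  have Bless: "|nb s \<inter> \<Union>F| <o |K|" if "s \<in> B" for s using that by (simp add: B_def not_card_of_le_iff)
  have less1: "card (X \<inter> S) < card (R \<inter> S)" if "X \<subseteq> R" "y \<in> R \<inter> S" "y \<notin> X" for X y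
    using finS that by (intro psubset_card_mono) auto
  define R0 where "R0 = R \<inter> ?V - B"
  have R0: "R0 \<subseteq> ?V" by (auto simp: R0_def)
  \<comment> \<open>\<open>q0\<close> gives the vertices of \<open>A\<close> their opponents in \<open>F\<close>, and \<open>q1\<close> gives those of \<open>B\<close> opponents outside \<open>F\<close>;
    changing \<open>q0\<close> on \<open>B\<close> to \<open>q1\<close> only affects fewer than \<open>|K|\<close> vertices in \<open>F\<close>.\<close>
  obtain q0 where q0: "extends_happily ?V R0 p q0"
    using solvable_belowD[OF sol dF R0 less1[of R0 b]] AB unfolding R0_def by blast
  obtain q1 where q1: "extends_happily ?W (R - A) q0 q1"
    using solvable_belowD[OF sol d _ less1[of "R - A" a]] R AB by blast
  \<comment> \<open>A countable part of \<open>K\<close> makes \<open>L\<close> infinite, yet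
    \<open>L\<close> stays smaller than \<open>K\<close> because \<open>K\<close> is
    uncountable.\<close>
  obtain N where N: "N \<subseteq> K" "|N| =o |UNIV :: nat set|"
    using K(2) by (metis card_of_ordLeq2 internalize_card_of_ordLeq2 ordIso_symmetric ordLess_imp_ordLeq)
  define L where "L = N \<union> (\<Union>s\<in>B. nb s \<inter> ?V)"
  have infN: "infinite N" using N(2) card_of_ordIso_finite by blast
  have infL: "infinite L" using infN by (simp add: L_def)
  have nB: "|nb s \<inter> ?V| <o |K|" if "s \<in> B" for s
  proof -
    have "|(nb s \<inter> S) \<union> (nb s \<inter> \<Union>F)| <o |K|"
      using card_of_Un_ordLess_infinite[OF infK card_of_finite_less_infinite[OF _ infK] Bless[OF that]] finS
      by simp
    then show ?thesis by (simp add: Int_Un_distrib)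
  qed
  have finB: "finite B" using finS by (simp add: B_def)
  have LK: "|L| <o |K|"
    unfolding L_def using card_of_UN_finite_less[OF finB infK nB] ordIso_ordLess_trans[OF N(2) K(2)]
    by (intro card_of_Un_ordLess_infinite[OF infK])
  have cB: "|B| \<le>o |L|" using card_of_finite_less_infinite[OF finB infL] ordLess_imp_ordLeq by blast
  have nBL: "|nb s \<inter> ?V| \<le>o |L|" if "s \<in> B" for s
    using that by (intro card_of_mono1) (auto simp: L_def)
  obtain Z where Z: "B \<subseteq> Z" "Z \<subseteq> B \<union> {x \<in> R0. |nb x \<inter> ?V| \<le>o |L| }"
    "\<And>p q x. (\<And>y. y \<notin> Z \<Longrightarrow> q y = p y) \<Longrightarrow> x \<in> R0 - Z \<Longrightarrow> content (nb x \<inter> ?V) p x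
      \<Longrightarrow> content (nb x \<inter> ?V) q x"
    by (rule recolouring_region[OF infL cB nBL R0]) auto
  have AK: "|K| \<le>o |nb s \<inter> ?V|" if "s \<in> A" for s
  proof -
    have "|nb s \<inter> \<Union>F| \<le>o |nb s \<inter> ?V|" by (rule card_of_mono1) auto
    then show ?thesis using that ordLeq_transitive unfolding A_def by blast
  qed
  \<comment> \<open>Vertices of \<open>A\<close> have at least \<open>|K|\<close> neighbours in
    \<open>?V\<close>, too many for the region.\<close>
  have AZ: "s \<notin> Z" if "s \<in> A" for s
  proof
    assume "s \<in> Z"
    then have "|nb s \<inter> ?V| \<le>o |L|" using Z(2) AB(2) that by blast
    then have "|K| \<le>o |L|" by (rule ordLeq_transitive[OF AK[OF that]])
    then show False using LK not_ordLeq_ordLess by blast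
  qed
  have ZR: "Z - B \<subseteq> R0" using Z(2) by blast
  \<comment> \<open>The colours of \<open>B\<close> are taken from \<open>q1\<close> before
    repairing the rest of the region. What is repaired, \<open>Z - B\<close>, lies in the pieces, so
    \<open>S\<close> keeps its colours.\<close>
  define q0' where "q0' x = (if x \<in> B then q1 x else q0 x)" for x
  have "(Z - B) \<inter> S = {}"
    using ZR AZ AB(1) unfolding R0_def by blast
  then have "Z - B \<subseteq> \<Union>F" using ZR R0 by blast
  then obtain q2 where q2: "extends_happily ?V (Z - B) q0' q2"
    using extends_if_kernel_fixed[OF dF] by blast
  have q02: "q2 y = q0 y" if "y \<notin> Z" for y
    using that q2 Z(1) by (auto simp: extends_happily_def q0'_def)
  have q2c: "content (nb x \<inter> ?V) q2 x" if "x \<in> R0" for x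
  proof (cases "x \<in> Z")
    case True
    then show ?thesis using q2 that by (auto simp: extends_happily_def R0_def)
  next
    case False
    have "content (nb x \<inter> ?V) q0 x" using q0 that by (simp add: extends_happily_def)
    then show ?thesis using Z(3)[of q2 q0 x] q02 False that by blast
  qed
  \<comment> \<open>By \<open>q2S\<close> below, \<open>q1\<close> and \<open>q2\<close> agree on
    \<open>S\<close>, through which alone the pieces inside and outside \<open>F\<close> are
    connected.\<close>
  define q where "q x = (if x \<in> ?V then q2 x else q1 x)" for x
  have q01R: "q1 x = q0 x" if "x \<notin> R - A" for x using that q1 by (simp add: extends_happily_def)
  have q0R: "q0 x = p x" if "x \<notin> R" for x using that q0 by (simp add: extends_happily_def R0_def)
  have q2R: "q2 x = p x" if "x \<notin> R" for x
  proof -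
    have "x \<notin> Z" using that ZR AB(1) unfolding R0_def by blast
    then show ?thesis using q02 q0R that by simp
  qed
  have q2S: "q2 x = q1 x" if xS: "x \<in> S" for x
  proof -
    consider "x \<in> A" | "x \<in> B" | "x \<notin> R" using xS AB(1) by blast
    then show ?thesis
    proof cases
      case 1
      then show ?thesis using q02[of x] AZ q01R by simp
    next
      case 2
      then show ?thesis using q2 by (simp add: extends_happily_def q0'_def)
    next
      case 3
      then show ?thesis using q2R q01R q0R by simp
    qed
  qed
  have qS: "q x = q1 x" if "x \<in> S" for x using that q2S by (simp add: q_def)
  have "content (nb x \<inter> ?W) q x" if x: "x \<in> R" for x
  proof -
    consider C where "C \<in> F" "x \<in> C" | C where "C \<in> P - F" "x \<in> C" | "x \<in> A" | "x \<in> B"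
      using x R AB(1) by blast
    then show ?thesis
    proof cases
      case 1
      have "x \<in> R0" using 1 x decompD(2)[OF dF 1(1)] by (auto simp: R0_def B_def)
      then have "content (nb x \<inter> ?V) q2 x" by (rule q2c)
      moreover have "nb x \<inter> ?W = nb x \<inter> ?V" using nb_piece_subfamily[OF d F 1] by simp
      ultimately show ?thesis using 1
        by (subst content_cong[of _ "nb x \<inter> ?V" _ _ q2]) (auto simp: q_def)
    next
      case 2
      then have xA: "x \<notin> A" using decompD(2)[OF d, of C] by (auto simp: A_def)
      then have c: "content (nb x \<inter> ?W) q1 x" using q1 x by (simp add: extends_happily_def)
      have "y \<notin> \<Union>F" if "y \<in> C" for y using that 2(1) F decompD(3)[OF d, of C _ y] by blast
      then have "q y = q1 y" if "y \<in> S \<union> C" for y using that qS by (auto simp: q_def)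
      moreover have "nb x \<inter> ?W = nb x \<inter> (S \<union> C)" using nb_piece[OF d, of C x] 2 by blast
      ultimately show ?thesis using 2(2) c
        by (subst content_cong[of _ "nb x \<inter> (S \<union> C)" _ _ q1]) auto
    next
      case 3
      have xRS: "x \<in> R \<inter> S" using 3 AB(1) by blast
      have "x \<in> R0" using xRS 3 AB(2) by (auto simp: R0_def)
      then have c: "content (nb x \<inter> ?V) q2 x" by (rule q2c)
      have i: "infinite (nb x \<inter> ?V)" using card_of_ordLeq_finite[OF AK[OF 3]] infK by blast
      have 1: "|nb x \<inter> ?V| \<le>o |{y \<in> nb x \<inter> ?V. q2 y \<noteq> q2 x}|" using c content_infinite_iff[OF i] by simp
      have 2: "|nb x \<inter> ?W| \<le>o |{y \<in> nb x \<inter> ?V. q2 y \<noteq> q2 x}|"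
        by (rule ordIso_ordLeq_trans[OF K(1)[OF xRS] ordLeq_transitive[OF AK[OF 3] 1]])
      have "{y \<in> nb x \<inter> ?V. q2 y \<noteq> q2 x} = {y \<in> nb x \<inter> ?V. q y \<noteq> q x}"
        using xRS by (auto simp: q_def)
      then show ?thesis using 2 F
        by (intro content_if_many_opponents[OF infW[OF xRS], of "nb x \<inter> ?V"]) auto
    next
      case 4
      have xRS: "x \<in> R \<inter> S" using 4 AB(1) by blast
      \<comment> \<open>\<open>q\<close> and \<open>q1\<close> differ only on
        \<open>\<Union>F\<close>, where a vertex of \<open>B\<close> has fewer than
        \<open>|K|\<close> neighbours.\<close>
      have c: "content (nb x \<inter> ?W) q1 x" using q1 4 AB(2) xRS by (auto simp: extends_happily_def)
      have "|nb x \<inter> \<Union>F| <o |nb x \<inter> ?W|"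
        by (rule ordLess_ordIso_trans[OF Bless[OF 4] ordIso_symmetric[OF K(1)[OF xRS]]])
      moreover have "q y = q1 y" if "y \<notin> \<Union>F" for y
        using that qS[of y] by (cases "y \<in> S") (auto simp: q_def)
      ultimately show ?thesis using qS[of x] xRS
        by (intro content_small_change[OF infW[OF xRS] c, of q "nb x \<inter> \<Union>F"]) blast+
    qed
  qed
  moreover have "q x = p x" if "x \<notin> R" for x using that q2R q01R q0R by (simp add: q_def)
  ultimately show ?thesis unfolding extends_happily_def by blast
qed


text \<open>Infinitely many opponents suffice here. Vertices in \<open>A\<close> have infinitely
  many neighbours in a single piece, so finitely many pieces \<open>F0\<close> serve them; those in
  \<open>B\<close> meet each piece finitely and need infinitely many blocks.\<close>

lemma extends_if_countable_degrees:
  assumes d: "decomp S P" and R: "R \<subseteq> S \<union> \<Union>P"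
    and inf: "\<And>s. s \<in> R \<inter> S \<Longrightarrow> infinite (nb s \<inter> (S \<union> \<Union>P))"
    and cnt: "\<And>s. s \<in> R \<inter> S \<Longrightarrow> |nb s \<inter> (S \<union> \<Union>P)| \<le>o |UNIV :: nat set|"
  shows "\<exists>q. extends_happily (S \<union> \<Union>P) R p q"
proof -
  let ?W = "S \<union> \<Union>P"
  have finS: "finite S" by (rule decompD(1)[OF d])
  have le_inf: "|nb s \<inter> ?W| \<le>o |X|" if "s \<in> R \<inter> S" "infinite X" for s and X :: "'a set"
    using ordLeq_transitive[OF cnt[OF that(1)]] that(2) infinite_iff_card_of_nat by blast
  define A where "A = {s \<in> R \<inter> S. \<exists>C\<in>P. infinite (nb s \<inter> C)}"
  define B where "B = R \<inter> S - A"
  have AB: "R \<inter> S = A \<union> B" by (auto simp: A_def B_def)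
  have "\<forall>s\<in>A. \<exists>C\<in>P. infinite (nb s \<inter> C)" by (auto simp: A_def)
  then obtain c where c: "\<And>s. s \<in> A \<Longrightarrow> c s \<in> P" "\<And>s. s \<in> A \<Longrightarrow> infinite (nb s \<inter> c s)" by metis
  define F0 where "F0 = c ` A"
  have F0: "F0 \<subseteq> P" "finite F0" using c finS by (auto simp: F0_def A_def)
  have infA: "infinite (nb s \<inter> \<Union>F0)" if "s \<in> A" for s
    by (rule infinite_super[OF _ c(2)[OF that]]) (use that in \<open>auto simp: F0_def\<close>)
  have finB: "finite (nb b \<inter> C)" if "b \<in> B" "C \<in> P" for b C using that by (auto simp: A_def B_def)
  show ?thesis
  proof (cases "B = {}")
    case True
    \<comment> \<open>Without \<open>B\<close>, a happy colouring of
      \<open>S \<union> \<Union>F0\<close> already provides the opponents and extends to the other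
      pieces.\<close>
    have "pre_part (S \<union> \<Union>F0)" using decompD(5)[OF d F0] by simp
    then obtain q0 where q0: "extends_happily (S \<union> \<Union>F0) (R \<inter> (S \<union> \<Union>F0)) p q0"
      unfolding pre_part_def by (metis Int_lower2)
    obtain q where q: "\<And>x. x \<notin> R \<inter> \<Union>(P - F0) \<Longrightarrow> q x = q0 x"
      "\<And>x. x \<in> R \<inter> \<Union>P \<Longrightarrow> content (nb x \<inter> ?W) q x"
      by (rule extends_from_subfamily[OF d F0(1), of R q0]) (use q0 in \<open>auto simp: extends_happily_def\<close>)
    have eq: "q x = q0 x" if "x \<in> S \<union> \<Union>F0" for x
    proof -
      have "x \<notin> C" if C: "C \<in> P - F0" for C
      proof
        assume "x \<in> C"
        then have "x \<in> \<Union>F0" using C \<open>x \<in> S \<union> \<Union>F0\<close> decompD(2)[OF d, of C] by blast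
        then obtain D where "D \<in> F0" "x \<in> D" by blast
        then show False using C \<open>x \<in> C\<close> decompD(3)[OF d, of C D x] F0(1) by blast
      qed
      then show ?thesis using q(1) by blast
    qed
    have "content (nb s \<inter> ?W) q s" if s: "s \<in> A" for s
    proof -
      let ?N = "nb s \<inter> (S \<union> \<Union>F0)"
      have sRS: "s \<in> R \<inter> S" using s AB by blast
      have i: "infinite ?N" by (rule infinite_super[OF _ infA[OF s]]) auto
      have "content ?N q0 s" using q0 sRS by (simp add: extends_happily_def)
      then have "|?N| \<le>o |{y \<in> ?N. q0 y \<noteq> q0 s}|" using content_infinite_iff[OF i] by simp
      then have "infinite {y \<in> ?N. q0 y \<noteq> q0 s}" using card_of_ordLeq_finite i by blast
      moreover have "{y \<in> ?N. q0 y \<noteq> q0 s} = {y \<in> ?N. q y \<noteq> q s}" using eq sRS by auto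
      ultimately have "infinite {y \<in> ?N. q y \<noteq> q s}" by simp
      then show ?thesis using le_inf[OF sRS] F0(1)
        by (intro content_if_many_opponents[OF inf[OF sRS], of ?N]) auto
    qed
    then have "content (nb x \<inter> ?W) q x" if "x \<in> R" for x
      using that q(2)[of x] R AB True by blast
    moreover have "q x = p x" if "x \<notin> R" for x using that q(1)[of x] q0 by (simp add: extends_happily_def)
    ultimately show ?thesis unfolding extends_happily_def by blast
  next
    case False
    show ?thesis
    proof (rule extends_by_blocks[OF d R F0 AB False, of finite])
      show "infinite (nb a \<inter> \<Union>F0)" "|nb a \<inter> ?W| \<le>o |nb a \<inter> \<Union>F0|" if "a \<in> A" for a
        using infA[OF that] le_inf that AB by blast+
      show "infinite (nb b \<inter> ?W)" if "b \<in> B" for b using inf that AB by blast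
      show "finite (nb b \<inter> \<Union>F0)" if "b \<in> B" for b
        using finB[OF that] F0 unfolding Int_Union by blast
      show "infinite (nb b \<inter> \<Union>(P - I))" if I: "finite I" and b: "b \<in> B" for I b
      proof
        assume f: "finite (nb b \<inter> \<Union>(P - I))"
        have "finite (\<Union>C\<in>P \<inter> I. nb b \<inter> C)" using I finB[OF b] by blast
        then have "finite (S \<union> (\<Union>C\<in>P \<inter> I. nb b \<inter> C) \<union> (nb b \<inter> \<Union>(P - I)))" using f finS by blast
        then have "finite (nb b \<inter> ?W)" by (rule rev_finite_subset) auto
        then show False using inf b AB by blast
      qed
      show "|nb b \<inter> ?W| \<le>o |nb b \<inter> \<Union>(\<Union>\<D>)|"
        if dis: "pairwise disjnt \<D>" and D: "\<forall>D\<in>\<D>. D \<subseteq> P \<and> finite D \<and> nb b \<inter> \<Union>D \<noteq> {}"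
          and "\<not> finite (\<Union>\<D>)" and b: "b \<in> B" for \<D> b
      proof -
        \<comment> \<open>The members of \<D> are finite and their union is not. Each of the
          infinitely many disjoint blocks then contributes its own neighbour of
          \<open>b\<close>.\<close>
        have inf\<D>: "infinite \<D>" using that by blast
        have "\<forall>D\<in>\<D>. \<exists>y. y \<in> nb b \<inter> \<Union>D" using D by blast
        then obtain y where y: "\<And>D. D \<in> \<D> \<Longrightarrow> y D \<in> nb b \<inter> \<Union>D" by metis
        have "inj_on y \<D>"
        proof (rule inj_onI)
          fix D D' assume DD: "D \<in> \<D>" "D' \<in> \<D>" "y D = y D'"
          obtain C C' where C: "C \<in> D" "C' \<in> D'" "y D \<in> C" "y D \<in> C'" using y DD by (metis IntD2 UnionE)
          then have "C = C'" using decompD(3)[OF d] D DD by blast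
          then show "D = D'" using dis DD C unfolding pairwise_def disjnt_def by blast
        qed
        then have "infinite (y ` \<D>)" using inf\<D> finite_imageD by blast
        moreover have "y ` \<D> \<subseteq> nb b \<inter> \<Union>(\<Union>\<D>)" using y by blast
        ultimately have "infinite (nb b \<inter> \<Union>(\<Union>\<D>))" using infinite_super by blast
        then show ?thesis using le_inf[of b] b AB by blast
      qed
    qed (use F0 in auto)
  qed
qed

text \<open>If no family splits the free separator vertices, whether a family has \<open>|K|\<close>
  neighbours of a vertex does not depend on the vertex. The block argument then applies with
  \<open>A\<close> and \<open>F0\<close> empty.\<close>

lemma extends_if_uncountable_degrees:
  fixes K :: "'a set"
  assumes d: "decomp S P" and R: "R \<subseteq> S \<union> \<Union>P" and sol: "solvable_below (card (R \<inter> S))"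
    and K: "\<And>s. s \<in> R \<inter> S \<Longrightarrow> |nb s \<inter> (S \<union> \<Union>P)| =o |K|" "|UNIV :: nat set| <o |K|" and ne: "R \<inter> S \<noteq> {}"
  shows "\<exists>q. extends_happily (S \<union> \<Union>P) R p q"
proof (cases "\<exists>F\<subseteq>P. \<exists>a\<in>R \<inter> S. \<exists>b\<in>R \<inter> S. |K| \<le>o |nb a \<inter> \<Union>F| \<and> \<not> |K| \<le>o |nb b \<inter> \<Union>F|")
  case True
  then obtain F a b where f: "F \<subseteq> P" "a \<in> R \<inter> S" "|K| \<le>o |nb a \<inter> \<Union>F|" "b \<in> R \<inter> S" "\<not> |K| \<le>o |nb b \<inter> \<Union>F|"
    by (elim exE bexE conjE)
  show ?thesis by (rule extends_if_subfamily_splits[OF d R sol _ K(2) f]) (rule K(1))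
next
  case False
  let ?W = "S \<union> \<Union>P"
  have finS: "finite S" by (rule decompD(1)[OF d])
  have infK: "infinite K"
    using card_of_ordLeq_finite[OF ordLess_imp_ordLeq[OF K(2)]] by auto
  have infW: "infinite (nb s \<inter> ?W)" if "s \<in> R \<inter> S" for s
    using card_of_ordIso_finite[OF K(1)[OF that]] infK by simp
  define small where "small I \<longleftrightarrow> I \<subseteq> P \<and> (\<forall>s\<in>R \<inter> S. |nb s \<inter> \<Union>I| <o |K| )" for I
  \<comment> \<open>Not being small exhibits one vertex with \<open>|K|\<close> neighbours; the
    absence of a split passes this on to all.\<close>
  have big: "|K| \<le>o |nb b \<inter> \<Union>I|" if I: "I \<subseteq> P" "\<not> small I" and b: "b \<in> R \<inter> S" for I b
  proof -
    obtain s where "s \<in> R \<inter> S" "|K| \<le>o |nb s \<inter> \<Union>I|"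
      using I unfolding small_def not_card_of_le_iff[symmetric] by blast
    then show ?thesis using False I(1) b by (metis (no_types))
  qed
  show ?thesis
  proof (rule extends_by_blocks[OF d R, of "{}" "{}" "R \<inter> S" small])
    show "small {}" using card_of_finite_less_infinite[OF _ infK, of "{} :: 'a set"] by (simp add: small_def)
    then show "small {}" .
    show "small (X \<union> Y)" if X: "small X" and Y: "small Y" for X Y
      unfolding small_def
    proof (intro conjI ballI)
      show "X \<union> Y \<subseteq> P" using X Y by (simp add: small_def)
      fix s assume "s \<in> R \<inter> S"
      then have "|(nb s \<inter> \<Union>X) \<union> (nb s \<inter> \<Union>Y)| <o |K|"
        using X Y by (intro card_of_Un_ordLess_infinite[OF infK]) (auto simp: small_def)
      then show "|nb s \<inter> \<Union>(X \<union> Y)| <o |K|" by (simp add: Int_Un_distrib)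
    qed
    show "infinite (nb b \<inter> \<Union>(P - I))" if I: "small I" and b: "b \<in> R \<inter> S" for I b
    proof -
      have "|S \<union> (nb b \<inter> \<Union>I)| <o |K|"
        using I b card_of_finite_less_infinite[OF finS infK]
        by (intro card_of_Un_ordLess_infinite[OF infK]) (auto simp: small_def)
      then have "|S \<union> (nb b \<inter> \<Union>I)| <o |nb b \<inter> ?W|"
        by (rule ordLess_ordIso_trans[OF _ ordIso_symmetric[OF K(1)[OF b]]])
      then have "|nb b \<inter> ?W| \<le>o |nb b \<inter> \<Union>(P - I)|"
        by (rule card_of_le_if_subset_Un[OF _ _ infW[OF b], rotated]) auto
      then show ?thesis using card_of_ordLeq_finite infW[OF b] by blast
    qed
    show "|nb b \<inter> ?W| \<le>o |nb b \<inter> \<Union>(\<Union>\<D>)|"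
      if "pairwise disjnt \<D>" and D: "\<forall>D\<in>\<D>. D \<subseteq> P \<and> finite D \<and> nb b \<inter> \<Union>D \<noteq> {}"
        and s: "\<not> small (\<Union>\<D>)" and b: "b \<in> R \<inter> S" for \<D> b
    proof -
      have "\<Union>\<D> \<subseteq> P" using D by blast
      then show ?thesis using ordIso_ordLeq_trans[OF K(1)[OF b] big[OF _ s b]] by blast
    qed
  qed (use ne infW in auto)
qed

text \<open>The cases are: some degree finite, two degrees different, all countable, all equal and
  uncountable. If no separator vertex is free, the countable case applies.\<close>

lemma extends_step:
  assumes d: "decomp S P" and R: "R \<subseteq> S \<union> \<Union>P" and sol: "solvable_below (card (R \<inter> S))"
  shows "\<exists>q. extends_happily (S \<union> \<Union>P) R p q"
proof -
  let ?W = "S \<union> \<Union>P"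
  show ?thesis
  proof (cases "\<exists>t\<in>R \<inter> S. finite (nb t \<inter> ?W)")
    case True
    then show ?thesis using extends_if_finite_degree[OF d R sol] by blast
  next
    case False
    then have inf: "\<And>t. t \<in> R \<inter> S \<Longrightarrow> infinite (nb t \<inter> ?W)" by blast
    show ?thesis
    proof (cases "\<exists>s\<in>R \<inter> S. \<exists>t\<in>R \<inter> S. |nb t \<inter> ?W| <o |nb s \<inter> ?W|")
      case True
      then show ?thesis using extends_if_degrees_differ[OF d R sol] inf by blast
    next
      case False
      then have le: "|nb s \<inter> ?W| \<le>o |nb t \<inter> ?W|" if "s \<in> R \<inter> S" "t \<in> R \<inter> S" for s t
        using that not_card_of_le_iff by blast
      show ?thesis
      proof (cases "\<forall>s\<in>R \<inter> S. |nb s \<inter> ?W| \<le>o |UNIV :: nat set|")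
        case True
        then show ?thesis using extends_if_countable_degrees[OF d R inf] by blast
      next
        case False
        then obtain k where k: "k \<in> R \<inter> S" "|UNIV :: nat set| <o |nb k \<inter> ?W|"
          using not_card_of_le_iff by blast
        have "|nb s \<inter> ?W| =o |nb k \<inter> ?W|" if "s \<in> R \<inter> S" for s
          using le that k(1) unfolding ordIso_iff_ordLeq by blast
        then show ?thesis using extends_if_uncountable_degrees[OF d R sol _ k(2)] k(1) by blast
      qed
    qed
  qed
qed

text \<open>The quantification over all decompositions and free sets is essential, as the cases
  above change \<open>S\<close>, \<open>P\<close> and \<open>R\<close>.\<close>

lemma solvable_below: "solvable_below n"
proof (induction n)
  case 0
  then show ?case by (simp add: solvable_below_def)
next
  case (Suc n)
  have "\<exists>q. extends_happily (S \<union> \<Union>P) R p q"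
    if a: "decomp S P" "R \<subseteq> S \<union> \<Union>P" "card (R \<inter> S) < Suc n" for S P R p
  proof -
    have "solvable_below (card (R \<inter> S))"
      using Suc a(3) unfolding solvable_below_def by (meson less_Suc_eq_le less_le_trans)
    then show ?thesis by (rule extends_step[OF a(1,2)])
  qed
  then show ?case unfolding solvable_below_def by blast
qed

lemma pre_part_decomp: "decomp S P \<Longrightarrow> pre_part (S \<union> \<Union>P)"
  unfolding pre_part_def using solvable_below extends_step by blast


section \<open>The closure\<close>

text \<open>Finite closedness for vertex sets of one fixed graph. A disjoint union of graphs becomes
  a union of disjoint sets with no edges between them.\<close>

definition good_family :: "'a set \<Rightarrow> 'a set set \<Rightarrow> bool" where
  "good_family V \<W> \<longleftrightarrow> (\<forall>W\<in>\<W>. pre_part W) \<and> (\<forall>W\<in>\<W>. \<forall>T\<subseteq>V. finite T \<longrightarrow> W \<union> T \<in> \<W>) \<and>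
    (\<forall>W\<in>\<W>. \<forall>W'\<in>\<W>. W \<inter> W' = {} \<longrightarrow> (\<forall>x\<in>W. \<forall>y\<in>W'. \<not> E x y) \<longrightarrow> W \<union> W' \<in> \<W>)"

text \<open>Finite nonempty unions of pieces, and their extensions by finite sets, stay in \<W>. The
  empty union leaves only \<open>T\<close>, which \<W> need not contain, but finite sets are
  pre-partitionable anyway.\<close>

lemma decomp_if_separated:
  assumes good: "good_family V \<W>" and sep: "separated S P" and S: "S \<subseteq> V" and P: "P \<subseteq> \<W>"
  shows "decomp S P"
proof -
  have U: "\<Union>F \<in> \<W>" if "finite F" "F \<noteq> {}" "F \<subseteq> P" for F
    using that
  proof (induction F rule: finite_ne_induct)
    case (singleton C)
    then show ?case using P by auto
  next
    case (insert C F)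
    have "\<Union>F \<in> \<W>" "C \<in> \<W>" using insert P by auto
    moreover have CD: "C \<in> P" "D \<in> P" "C \<noteq> D" if "D \<in> F" for D using insert that by auto
    have "C \<inter> D = {}" "\<forall>x\<in>C. \<forall>y\<in>D. \<not> E x y" if "D \<in> F" for D
      using sep CD[OF that] by (simp_all add: separated_def pairwise_def disjnt_def)
    then have "C \<inter> \<Union>F = {}" "\<forall>x\<in>C. \<forall>y\<in>\<Union>F. \<not> E x y" by blast+
    ultimately show ?case using good unfolding good_family_def by simp
  qed
  have "pre_part (T \<union> \<Union>F)" if F: "F \<subseteq> P" "finite F" and T: "T \<subseteq> S" for F T
  proof -
    have fT: "finite T" "T \<subseteq> V" using T S sep finite_subset by (auto simp: separated_def)
    show ?thesis
    proof (cases "F = {}")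
      case True
      then show ?thesis using pre_part_finite fT by simp
    next
      case False
      then have "\<Union>F \<union> T \<in> \<W>" using U F fT good unfolding good_family_def by blast
      then show ?thesis using good unfolding good_family_def by (simp add: Un_commute)
    qed
  qed
  then show ?thesis using sep by (simp add: decomp_def separated_def)
qed

definition step_family :: "'a set \<Rightarrow> 'a set set \<Rightarrow> 'a set set" where
  "step_family V \<W> = {S \<union> \<Union>P | S P. separated S P \<and> S \<subseteq> V \<and> P \<subseteq> \<W>}"

text \<open>Added vertices join the separator; for a union of two members, the separators and the
  families of pieces are united.\<close>

lemma good_family_step_family:
  assumes good: "good_family V \<W>"
  shows "good_family V (step_family V \<W>)"
  unfolding good_family_def
proof (intro conjI ballI allI impI)
  show "pre_part W" if "W \<in> step_family V \<W>" for W
    using that pre_part_decomp decomp_if_separated[OF good] unfolding step_family_def by blast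
  show "W \<union> T \<in> step_family V \<W>" if W: "W \<in> step_family V \<W>" and T: "T \<subseteq> V" "finite T" for W T
  proof -
    obtain S P where SP: "W = S \<union> \<Union>P" "separated S P" "S \<subseteq> V" "P \<subseteq> \<W>" using W unfolding step_family_def by blast
    \<comment> \<open>Adding only \<open>T - W\<close> keeps the separator disjoint from the
      pieces.\<close>
    have "W \<union> T = (S \<union> (T - W)) \<union> \<Union>P" using SP(1) by blast
    moreover have "separated (S \<union> (T - W)) P"
      using SP(1,2) T(2) by (auto simp: separated_def)
    moreover have "S \<union> (T - W) \<subseteq> V" using SP T by blast
    ultimately show ?thesis using SP(4) unfolding step_family_def by blast
  qed
  show "W \<union> W' \<in> step_family V \<W>"
    if W: "W \<in> step_family V \<W>" "W' \<in> step_family V \<W>" "W \<inter> W' = {}" "\<forall>x\<in>W. \<forall>y\<in>W'. \<not> E x y" for W W'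
  proof -
    obtain S P where SP: "W = S \<union> \<Union>P" "separated S P" "S \<subseteq> V" "P \<subseteq> \<W>"
      using W(1) unfolding step_family_def by blast
    obtain S' P' where SP': "W' = S' \<union> \<Union>P'" "separated S' P'" "S' \<subseteq> V" "P' \<subseteq> \<W>"
      using W(2) unfolding step_family_def by blast
    have mixed: "C \<inter> D = {} \<and> (\<forall>x\<in>C. \<forall>y\<in>D. \<not> E x y \<and> \<not> E y x)" if "C \<in> P" "D \<in> P'" for C D
      using that W(3,4) SP(1) SP'(1) E_sym by blast
    have "separated (S \<union> S') (P \<union> P')"
      unfolding separated_def
    proof (intro conjI)
      show "finite (S \<union> S')" using SP(2) SP'(2) by (simp add: separated_def)
      show "\<forall>C\<in>P \<union> P'. C \<inter> (S \<union> S') = {}"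
      proof
        fix C assume "C \<in> P \<union> P'"
        then show "C \<inter> (S \<union> S') = {}"
        proof
          assume C: "C \<in> P"
          then have "C \<inter> S = {}" using SP(2) by (simp add: separated_def)
          then show ?thesis using C W(3) SP(1) SP'(1) by blast
        next
          assume C: "C \<in> P'"
          then have "C \<inter> S' = {}" using SP'(2) by (simp add: separated_def)
          then show ?thesis using C W(3) SP(1) SP'(1) by blast
        qed
      qed
      show "pairwise disjnt (P \<union> P')"
      proof (rule pairwiseI)
        fix C D assume CD: "C \<in> P \<union> P'" "D \<in> P \<union> P'" "C \<noteq> D"
        have "disjnt C D" if "C \<in> P" "D \<in> P" using that CD(3) SP(2) by (simp add: separated_def pairwise_def)
        moreover have "disjnt C D" if "C \<in> P'" "D \<in> P'"
          using that CD(3) SP'(2) by (simp add: separated_def pairwise_def)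
        moreover have "disjnt C D" if "C \<in> P" "D \<in> P'" using mixed[OF that] by (simp add: disjnt_def)
        moreover have "disjnt C D" if "C \<in> P'" "D \<in> P" using mixed[OF that(2,1)] by (auto simp: disjnt_def)
        ultimately show "disjnt C D" using CD by blast
      qed
      show "\<forall>C\<in>P \<union> P'. \<forall>D\<in>P \<union> P'. C \<noteq> D \<longrightarrow> (\<forall>x\<in>C. \<forall>y\<in>D. \<not> E x y)"
      proof (intro ballI impI)
        fix C D x y assume CD: "C \<in> P \<union> P'" "D \<in> P \<union> P'" "C \<noteq> D" "x \<in> C" "y \<in> D"
        have "\<not> E x y" if "C \<in> P" "D \<in> P" using that CD(3-5) SP(2) by (simp add: separated_def)
        moreover have "\<not> E x y" if "C \<in> P'" "D \<in> P'" using that CD(3-5) SP'(2) by (simp add: separated_def)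
        moreover have "\<not> E x y" if "C \<in> P" "D \<in> P'" using mixed[OF that] CD(4,5) by simp
        moreover have "\<not> E x y" if "C \<in> P'" "D \<in> P" using mixed[OF that(2,1)] CD(4,5) by simp
        ultimately show "\<not> E x y" using CD by blast
      qed
    qed
    moreover have "W \<union> W' = (S \<union> S') \<union> \<Union>(P \<union> P')" using SP(1) SP'(1) by blast
    moreover have "S \<union> S' \<subseteq> V" "P \<union> P' \<subseteq> \<W>" using SP SP' by auto
    ultimately show ?thesis unfolding step_family_def by blast
  qed
qed

lemma subset_step_family: "\<W> \<subseteq> step_family V \<W>"
proof
  fix W assume W: "W \<in> \<W>"
  have "separated {} {W}" by (simp add: separated_def)
  moreover have "W = {} \<union> \<Union>{W}" by simp
  ultimately show "W \<in> step_family V \<W>" using W unfolding step_family_def by blast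
qed

text \<open>A maximal good family above \<open>\<W>0\<close> is its own step family, since the
  latter is good and contains it.\<close>

lemma ex_step_closed_good_family:
  assumes good: "good_family V \<W>0"
  obtains \<W> where "\<W>0 \<subseteq> \<W>" "good_family V \<W>" "step_family V \<W> \<subseteq> \<W>"
proof -
  define \<A> where "\<A> = {\<W>. \<W>0 \<subseteq> \<W> \<and> good_family V \<W>}"
  have "\<exists>M\<in>\<A>. \<forall>X\<in>\<A>. M \<subseteq> X \<longrightarrow> X = M"
  proof (rule subset_Zorn_nonempty)
    show "\<A> \<noteq> {}" using good by (auto simp: \<A>_def)
    fix C assume ne: "C \<noteq> {}" and C: "subset.chain \<A> C"
    have g: "good_family V X" "\<W>0 \<subseteq> X" if "X \<in> C" for X
      using C that by (auto simp: subset_chain_def \<A>_def)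
    have "good_family V (\<Union>C)"
      unfolding good_family_def
    proof (intro conjI ballI allI impI)
      show "pre_part W" if "W \<in> \<Union>C" for W using that g(1) unfolding good_family_def by blast
      show "W \<union> T \<in> \<Union>C" if "W \<in> \<Union>C" "T \<subseteq> V" "finite T" for W T
        using that g(1) unfolding good_family_def by blast
      fix W W' assume W: "W \<in> \<Union>C" "W' \<in> \<Union>C" "W \<inter> W' = {}" "\<forall>x\<in>W. \<forall>y\<in>W'. \<not> E x y"
      then obtain X Y where XY: "X \<in> C" "Y \<in> C" "W \<in> X" "W' \<in> Y" by blast
      then have "X \<subseteq> Y \<or> Y \<subseteq> X" using C by (auto simp: subset_chain_def)
      then obtain Z where Z: "Z \<in> C" "W \<in> Z" "W' \<in> Z" using XY by blast
      then have "W \<union> W' \<in> Z" using g(1)[OF Z(1)] W(3,4) unfolding good_family_def by blast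
      then show "W \<union> W' \<in> \<Union>C" using Z by blast
    qed
    moreover have "\<W>0 \<subseteq> \<Union>C" using ne g(2) by blast
    ultimately show "\<Union>C \<in> \<A>" by (simp add: \<A>_def)
  qed
  then obtain M where M: "M \<in> \<A>" "\<And>X. X \<in> \<A> \<Longrightarrow> M \<subseteq> X \<Longrightarrow> X = M" by blast
  have "step_family V M \<in> \<A>" using M(1) good_family_step_family subset_trans[OF _ subset_step_family] by (simp add: \<A>_def)
  then have "step_family V M = M" using M(2) subset_step_family by blast
  then show ?thesis using that[of M] M(1) by (auto simp: \<A>_def)
qed

end

section \<open>From graphs to vertex sets and back\<close>

lemma verts_induced [simp]: "verts (induced G W) = verts G \<inter> W"
  by (simp add: induced_def)

lemma adj_induced: "adj (induced G W) x y \<longleftrightarrow> adj G x y \<and> x \<in> W \<and> y \<in> W"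
  by (auto simp: adj_def induced_def)

lemma induced_induced: "induced (induced G W) X = induced G (W \<inter> X)"
  by (auto simp: induced_def)

lemma induced_eq_self: "is_graph G \<Longrightarrow> induced G (verts G) = G"
  by (cases G) (auto simp: induced_def is_graph_def)

lemma is_graph_induced: "is_graph G \<Longrightarrow> is_graph (induced G W)"
  by (fastforce simp: induced_def is_graph_def)

lemma graph_relation_adj: "is_graph G \<Longrightarrow> graph_relation (adj G)"
  by unfold_locales (auto simp: adj_def is_graph_def insert_commute dest!: bspec)

lemma happy_induced_iff_content:
  assumes gr: "graph_relation (adj G)" and x: "x \<in> W" and pq: "\<And>y. y \<in> W \<Longrightarrow> q y \<longleftrightarrow> \<pi> y = 1"
    and part: "is_partition \<pi> W"
  shows "happy (induced G W) \<pi> x \<longleftrightarrow> content (graph_relation.nb (adj G) x \<inter> W) q x"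
proof -
  have "\<pi> y = 0 \<or> \<pi> y = 1" if "y \<in> W" for y using part that by (auto simp: is_partition_def Pi_iff)
  then have eq: "\<pi> y = \<pi> x \<longleftrightarrow> q y = q x" if "y \<in> W" for y
    using pq[OF that] pq[OF x] x that by (metis zero_neq_one)
  have "friends (induced G W) \<pi> x = {y \<in> graph_relation.nb (adj G) x \<inter> W. q y = q x}"
    "opponents (induced G W) \<pi> x = {y \<in> graph_relation.nb (adj G) x \<inter> W. q y \<noteq> q x}"
    using eq x by (auto simp: friends_def opponents_def adj_induced graph_relation.nb_def[OF gr])
  then show ?thesis by (simp add: happy_def content_def lepoll_def card_of_ordLeq)
qed

text \<open>A partition given on \<open>X\<close> corresponds to the free set \<open>W - X\<close>;
  colour 1 corresponds to \<open>True\<close>.\<close>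

lemma pre_partitionable_induced_iff:
  assumes G: "is_graph G" and W: "W \<subseteq> verts G"
  shows "pre_partitionable (induced G W) \<longleftrightarrow> graph_relation.pre_part (adj G) W"
proof -
  interpret graph_relation "adj G" by (rule graph_relation_adj[OF G])
  have vW: "verts (induced G W) = W" using W by auto
  show ?thesis
  proof
    assume pre: "pre_partitionable (induced G W)"
    show "pre_part W"
      unfolding pre_part_def
    proof (intro allI impI)
      fix R and p :: "'a \<Rightarrow> bool" assume R: "R \<subseteq> W"
      define \<pi> :: "'a \<Rightarrow> nat" where "\<pi> x = (if p x then 1 else 0)" for x
      have "is_partition \<pi> (W - R)" by (auto simp: is_partition_def \<pi>_def)
      then obtain \<pi>' where \<pi>': "is_partition \<pi>' W" "\<forall>x\<in>W - R. \<pi>' x = \<pi> x"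
        "\<forall>x\<in>W - (W - R). happy (induced G W) \<pi>' x"
        using pre[unfolded pre_partitionable_def vW, rule_format, of "W - R" \<pi>] by auto
      define q where "q x = (if x \<in> R then \<pi>' x = 1 else p x)" for x
      have q: "q y \<longleftrightarrow> \<pi>' y = 1" if "y \<in> W" for y using that \<pi>'(2) by (auto simp: q_def \<pi>_def)
      have "content (nb x \<inter> W) q x" if x: "x \<in> R" for x
      proof -
        have "x \<in> W" "happy (induced G W) \<pi>' x" using R x \<pi>'(3) by auto
        then show ?thesis using happy_induced_iff_content[OF graph_relation_axioms _ q \<pi>'(1)] by blast
      qed
      then show "\<exists>q. extends_happily W R p q"
        unfolding extends_happily_def by (intro exI[of _ q]) (simp add: q_def)
    qed
  next
    assume pre_part: "pre_part W"
    show "pre_partitionable (induced G W)"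
      unfolding pre_partitionable_def vW
    proof (intro allI impI)
      fix X and \<pi> :: "'a \<Rightarrow> nat" assume X: "X \<subseteq> W \<and> is_partition \<pi> X"
      obtain q where q: "extends_happily W (W - X) (\<lambda>x. \<pi> x = 1) q"
        using pre_part[unfolded pre_part_def, rule_format, of "W - X"] by auto
      define \<pi>' :: "'a \<Rightarrow> nat" where "\<pi>' x = (if q x then 1 else 0)" for x
      have part: "is_partition \<pi>' W" by (auto simp: is_partition_def \<pi>'_def)
      moreover have "\<forall>x\<in>X. \<pi>' x = \<pi> x"
        using q X by (auto simp: extends_happily_def \<pi>'_def is_partition_def Pi_iff)
      moreover have "happy (induced G W) \<pi>' x" if "x \<in> W - X" for x
      proof -
        have "content (nb x \<inter> W) q x" using q that by (simp add: extends_happily_def)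
        then show ?thesis
          using happy_induced_iff_content[OF graph_relation_axioms, of x W q \<pi>'] part that by (simp add: \<pi>'_def)
      qed
      ultimately show "\<exists>\<pi>'. is_partition \<pi>' W \<and> (\<forall>x\<in>X. \<pi>' x = \<pi> x) \<and>
          (\<forall>x\<in>W - X. happy (induced G W) \<pi>' x)" by blast
    qed
  qed
qed

text \<open>With no edges between disjoint \<open>W\<close> and \<open>W'\<close>, the graph induced
  on \<open>W \<union> W'\<close> is literally the disjoint union of the two induced graphs.\<close>

lemma good_family_induced:
  assumes fc: "finitely_closed \<U>" and pre: "\<forall>H\<in>\<U>. pre_partitionable H" and G: "is_graph G"
  shows "graph_relation.good_family (adj G) (verts G) {W. W \<subseteq> verts G \<and> induced G W \<in> \<U>}"
proof -
  interpret graph_relation "adj G" by (rule graph_relation_adj[OF G])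
  show ?thesis
    unfolding good_family_def
  proof (intro conjI ballI allI impI)
    show "pre_part W" if "W \<in> {W. W \<subseteq> verts G \<and> induced G W \<in> \<U>}" for W
      using that pre pre_partitionable_induced_iff[OF G] by blast
    show "W \<union> T \<in> {W. W \<subseteq> verts G \<and> induced G W \<in> \<U>}"
      if "W \<in> {W. W \<subseteq> verts G \<and> induced G W \<in> \<U>}" and T: "T \<subseteq> verts G" "finite T" for W T
    proof -
      have W: "W \<subseteq> verts G" "induced G W \<in> \<U>" using that by auto
      have "induced (induced G (W \<union> T)) (verts (induced G W)) = induced G W"
        using W(1) by (auto simp: induced_induced intro!: arg_cong[where f = "induced G"])
      moreover have "verts (induced G W) \<subseteq> verts (induced G (W \<union> T))"
        "finite (verts (induced G (W \<union> T)) - verts (induced G W))"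
        using T(2) by (auto intro: rev_finite_subset)
      ultimately have "induced G (W \<union> T) \<in> \<U>"
        using fc W(2) is_graph_induced[OF G] unfolding finitely_closed_def by blast
      then show ?thesis using W(1) T(1) by simp
    qed
    show "W \<union> W' \<in> {W. W \<subseteq> verts G \<and> induced G W \<in> \<U>}"
      if "W \<in> {W. W \<subseteq> verts G \<and> induced G W \<in> \<U>}" "W' \<in> {W. W \<subseteq> verts G \<and> induced G W \<in> \<U>}"
        and disj: "W \<inter> W' = {}" "\<forall>x\<in>W. \<forall>y\<in>W'. \<not> adj G x y" for W W'
    proof -
      have W: "W \<subseteq> verts G" "induced G W \<in> \<U>" "W' \<subseteq> verts G" "induced G W' \<in> \<U>" using that by auto
      have "e \<subseteq> W \<or> e \<subseteq> W'" if e: "e \<in> edges G" "e \<subseteq> W \<union> W'" for e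
      proof -
        obtain x y where "e = {x, y}" using e(1) G unfolding is_graph_def by blast
        then show ?thesis using e disj(2) by (auto simp: adj_def insert_commute)
      qed
      then have "edges (induced G (W \<union> W')) = edges (induced G W) \<union> edges (induced G W')"
        by (auto simp: induced_def)
      moreover have "verts (induced G (W \<union> W')) = verts (induced G W) \<union> verts (induced G W')" by auto
      ultimately have "induced G (W \<union> W') =
          Graph (verts (induced G W) \<union> verts (induced G W')) (edges (induced G W) \<union> edges (induced G W'))"
        by (metis graph.collapse)
      moreover have "verts (induced G W) \<inter> verts (induced G W') = {}" using disj(1) by auto
      ultimately have "induced G (W \<union> W') \<in> \<U>"
        using fc W(2,4) unfolding finitely_closed_def by metis
      then show ?thesis using W by simp
    qed
  qed
qed

text \<open>The pieces are the reachability classes in \<open>W - S\<close>: each induces a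
  component, and no edge joins two of them.\<close>

lemma in_step_family_if_components:
  assumes G: "is_graph G" and W: "W \<subseteq> verts G" and S: "finite S" "S \<subseteq> W"
    and comp: "\<And>X. X \<subseteq> verts G \<Longrightarrow> induced G X \<in> components (induced G (W - S)) \<Longrightarrow> X \<in> \<W>"
  shows "W \<in> graph_relation.step_family (adj G) (verts G) \<W>"
proof -
  interpret graph_relation "adj G" by (rule graph_relation_adj[OF G])
  define r where "r = (adj (induced G (W - S)))\<^sup>*\<^sup>*"
  define C where "C x = {y. r x y}" for x
  define P where "P = C ` (W - S)"
  have r_in: "y \<in> W - S" if "r x y" "x \<in> W - S" for x y
    using that unfolding r_def by (induction rule: rtranclp_induct) (auto simp: adj_induced)
  have "symp (adj (induced G (W - S)))"
    using E_sym by (auto simp: symp_def adj_induced)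
  then have r_sym: "r y x" if "r x y" for x y
    using that unfolding r_def by (metis sympD symp_rtranclp)
  have r_trans: "r x z" if "r x y" "r y z" for x y z using that unfolding r_def by (rule rtranclp_trans)
  have C_eq: "C x = C y" if "r x y" for x y
    using that r_sym r_trans unfolding C_def by blast
  have C_sub: "C x \<subseteq> W - S" if "x \<in> W - S" for x using r_in that by (auto simp: C_def)
  have C_refl: "x \<in> C x" for x by (simp add: C_def r_def)
  have cover: "\<Union>P = W - S" using C_sub C_refl unfolding P_def by blast
  have P_eq: "X = Y" if XY: "X \<in> P" "Y \<in> P" "x \<in> X" "y \<in> Y" "r x y" for X Y x y
  proof -
    obtain a b where "X = C a" "Y = C b" using XY by (auto simp: P_def)
    then have "r a x" "r b y" using XY by (auto simp: C_def)
    then have "r a b" using XY(5) r_sym r_trans by blast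
    then show ?thesis using C_eq \<open>X = C a\<close> \<open>Y = C b\<close> by blast
  qed
  have "separated S P"
    unfolding separated_def
  proof (intro conjI ballI impI)
    show "finite S" by fact
    show "X \<inter> S = {}" if "X \<in> P" for X using that cover by blast
    show "pairwise disjnt P"
      unfolding pairwise_def disjnt_def using P_eq by (metis disjoint_iff r_def rtranclp.rtrancl_refl)
    show "\<not> adj G x y" if X: "X \<in> P" "Y \<in> P" "X \<noteq> Y" "x \<in> X" "y \<in> Y" for X Y x y
    proof
      assume "adj G x y"
      moreover have "x \<in> W - S" "y \<in> W - S" using X cover by blast+
      ultimately have "r x y" by (auto simp: r_def adj_induced)
      then show False using P_eq X by blast
    qed
  qed
  moreover have "P \<subseteq> \<W>"
  proof
    fix X assume "X \<in> P"
    then obtain x where x: "x \<in> W - S" "X = C x" by (auto simp: P_def)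
    have "induced G X = induced (induced G (W - S)) {y. (adj (induced G (W - S)))\<^sup>*\<^sup>* x y}"
      using C_sub[OF x(1)] x(2) by (auto simp: induced_induced C_def r_def intro!: arg_cong[where f = "induced G"])
    then have "induced G X \<in> components (induced G (W - S))"
      unfolding components_def using x(1) W by auto
    then show "X \<in> \<W>" using comp C_sub[OF x(1)] x(2) W by blast
  qed
  moreover have "W = S \<union> \<Union>P" using cover S by blast
  moreover have "S \<subseteq> verts G" using S W by blast
  ultimately show ?thesis unfolding step_family_def by blast
qed

theorem theorem5:
  fixes \<U> :: "'a graph set"
  assumes "graph_class \<U>"
    and "finitely_closed \<U>"
    and "\<forall>G\<in>\<U>. pre_partitionable G"
  shows "\<forall>G\<in>graph_closure \<U>. pre_partitionable G"
proof
  fix G assume "G \<in> graph_closure \<U>"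
  then obtain \<nu> :: "'a graph set rel" where \<nu>: "G \<in> stage \<U> \<nu>" by (auto simp: graph_closure_def)
  \<comment> \<open>At the bottom stage this comes from \<open>graph_class\<close>, at the others
    from the definition of \<open>stage\<close>.\<close>
  have G: "is_graph G"
    using \<nu> assms(1) unfolding stage.simps[of \<U> \<nu>] by (auto simp: graph_class_def split: if_splits)
  interpret graph_relation "adj G" by (rule graph_relation_adj[OF G])
  obtain \<W> where \<W>: "{W. W \<subseteq> verts G \<and> induced G W \<in> \<U>} \<subseteq> \<W>" "good_family (verts G) \<W>"
    "step_family (verts G) \<W> \<subseteq> \<W>"
    using ex_step_closed_good_family[OF good_family_induced[OF assms(2,3) G]] by blast
  \<comment> \<open>All components met on the way down are induced subgraphs of \<open>G\<close>, so
    the induction on \<mu> can run over vertex sets of \<open>G\<close> with one fixed \<W>.\<close>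
  have "W \<in> \<W>" if "W \<subseteq> verts G" "induced G W \<in> stage \<U> \<mu>" for W and \<mu> :: "'a graph set rel"
    using that
  proof (induction \<mu> arbitrary: W rule: wf_induct_rule[OF wf_ordLess])
    case (1 \<mu>)
    show ?case
    proof (cases "\<mu> = {}")
      case True
      then show ?thesis using 1(2,3) \<W>(1) by (auto simp: stage_empty)
    next
      case False
      have "\<exists>S. finite S \<and> S \<subseteq> verts (induced G W) \<and>
          (\<forall>C\<in>components (del_verts (induced G W) S). \<exists>\<kappa> :: 'a graph set rel. \<kappa> <o \<mu> \<and> C \<in> stage \<U> \<kappa>)"
        using 1(3) unfolding stage.simps[of \<U> \<mu>] if_not_P[OF False] mem_Collect_eq by (elim conjE)
      then obtain S where S: "finite S" "S \<subseteq> W"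
        "\<forall>C\<in>components (del_verts (induced G W) S). \<exists>\<kappa> :: 'a graph set rel. \<kappa> <o \<mu> \<and> C \<in> stage \<U> \<kappa>"
        by auto
      have "del_verts (induced G W) S = induced G (W - S)"
        using 1(2) by (auto simp: del_verts_def induced_induced intro!: arg_cong[where f = "induced G"])
      then have "X \<in> \<W>" if "X \<subseteq> verts G" "induced G X \<in> components (induced G (W - S))" for X
        using S(3) that 1(1) by metis
      then have "W \<in> step_family (verts G) \<W>" by (intro in_step_family_if_components[OF G 1(2) S(1,2)])
      then show ?thesis using \<W>(3) by blast
    qed
  qed
  then have "verts G \<in> \<W>" using \<nu> induced_eq_self[OF G] by simp
  then have "pre_part (verts G)" using \<W>(2) by (simp add: good_family_def)
  then show "pre_partitionable G"
    using pre_partitionable_induced_iff[OF G subset_refl] induced_eq_self[OF G] by simp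
qed

end
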